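(* Let $\nu_k\to0^+$, $c_k\in J_{\nu_k}$, $\nu_k^{-2}|c_k|\to\infty$. Assume $\hat c_k:=|c_k|^{-1}c_k\to\hat c\in\mathring J_0$. Then for any $\epsilon>0$ and any positive integer $m$, there exists a constant $C$, depending only on $\epsilon,m$ and $\hat c$, such that for large $k$, $$\|U^+_{\nu_k,\theta}(c_k)-\sqrt{2P_{c_k}}\|_{L^\infty(-1,1)}+\|U^-_{\nu_k,\theta}(c_k)+\sqrt{2P_{c_k}}\|_{L^\infty(-1,1)}\le C\nu_k,$$ $$\|U^+_{\nu_k,\theta}(c_k)-\sqrt{2P_{c_k}}\|_{C^m[-1,1-\epsilon]}+\|U^-_{\nu_k,\theta}(c_k)+\sqrt{2P_{c_k}}\|_{C^m[-1+\epsilon,1]}\le C\nu_k.$$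
   Context: For $c=(c_1,c_2,c_3)\in\mathbb{R}^3$ let $P_c(x)=c_1(1-x)+c_2(1+x)+c_3(1-x^2)$. For $\nu\ge0$ let $$\bar c_3(c_1,c_2;\nu)=-\tfrac12\left(\sqrt{\nu^2+c_1}+\sqrt{\nu^2+c_2}\right)\left(\sqrt{\nu^2+c_1}+\sqrt{\nu^2+c_2}+2\nu\right),$$ $$J_\nu=\{c\in\mathbb{R}^3: c_1\ge-\nu^2,\ c_2\ge-\nu^2,\ c_3\ge\bar c_3(c_1,c_2;\nu)\},$$ and let $\mathring J_\nu$ be its interior. For $\nu>0$ and $c\in J_\nu$, consider the differential equation $$\nu(1-x^2)U'+2\nu xU+\tfrac12U^2=P_c(x),\qquad -1<x<1.$$ It is known that among its $C^1(-1,1)$ solutions there are a greatest one $U^+_{\nu,\theta}(c)$ (upper solution) and a least one $U^-_{\nu,\theta}(c)$ (lower solution), i.e. $U^-_{\nu,\theta}(c)\le U\le U^+_{\nu,\theta}(c)$ on $(-1,1)$ for every solution $U$; solutions extend continuously to $[-1,1]$. *)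

theory Defs
  imports "HOL-Analysis.Analysis" "HOL-Probability.Essential_Supremum"
begin

definition P :: "real ^ 3 \<Rightarrow> real \<Rightarrow> real" where
  "P c x = c $ 1 * (1 - x) + c $ 2 * (1 + x) + c $ 3 * (1 - x\<^sup>2)"

definition cbar3 :: "real \<Rightarrow> real \<Rightarrow> real \<Rightarrow> real" where
  "cbar3 c1 c2 \<nu> =
     - (1 / 2) * (sqrt (\<nu>\<^sup>2 + c1) + sqrt (\<nu>\<^sup>2 + c2))
       * (sqrt (\<nu>\<^sup>2 + c1) + sqrt (\<nu>\<^sup>2 + c2) + 2 * \<nu>)"

definition J :: "real \<Rightarrow> (real ^ 3) set" where
  "J \<nu> = {c. c $ 1 \<ge> - (\<nu>\<^sup>2) \<and> c $ 2 \<ge> - (\<nu>\<^sup>2) \<and> c $ 3 \<ge> cbar3 (c $ 1) (c $ 2) \<nu>}"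

text \<open>Solutions live on the open interval \<open>(-1, 1)\<close>; the values of the HOL function
  elsewhere are irrelevant.\<close>

definition is_solution :: "real \<Rightarrow> real ^ 3 \<Rightarrow> (real \<Rightarrow> real) \<Rightarrow> bool" where
  "is_solution \<nu> c U \<longleftrightarrow>
     U C1_differentiable_on {-1<..<1} \<and>
     (\<forall>x\<in>{-1<..<1}. \<nu> * (1 - x\<^sup>2) * deriv U x + 2 * \<nu> * x * U x + 1 / 2 * (U x)\<^sup>2 = P c x)"

definition is_upper_solution :: "real \<Rightarrow> real ^ 3 \<Rightarrow> (real \<Rightarrow> real) \<Rightarrow> bool" where
  "is_upper_solution \<nu> c U \<longleftrightarrow>
     is_solution \<nu> c U \<and> (\<forall>V. is_solution \<nu> c V \<longrightarrow> (\<forall>x\<in>{-1<..<1}. V x \<le> U x))"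

definition is_lower_solution :: "real \<Rightarrow> real ^ 3 \<Rightarrow> (real \<Rightarrow> real) \<Rightarrow> bool" where
  "is_lower_solution \<nu> c U \<longleftrightarrow>
     is_solution \<nu> c U \<and> (\<forall>V. is_solution \<nu> c V \<longrightarrow> (\<forall>x\<in>{-1<..<1}. U x \<le> V x))"

definition Linf_norm :: "real set \<Rightarrow> (real \<Rightarrow> real) \<Rightarrow> ennreal" where
  "Linf_norm S f = esssup (lebesgue_on S) (\<lambda>x. ennreal \<bar>f x\<bar>)"

text \<open>\<open>C\<^sup>m[a, b]\<close> consists of the functions that are \<open>m\<close> times differentiable on \<open>(a, b)\<close> and
  whose derivatives of order \<open>0, \<dots>, m\<close> all extend continuously to \<open>[a, b]\<close>. Only values on
  the open interval enter, so the suprema in the norm are taken there; by continuity of the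
  extensions they agree with the suprema over \<open>[a, b]\<close>. The norm is \<open>\<infinity>\<close> outside
  \<open>C\<^sup>m[a, b]\<close>, so a finite bound includes membership.\<close>

definition Cm_on_closed :: "nat \<Rightarrow> real \<Rightarrow> real \<Rightarrow> (real \<Rightarrow> real) \<Rightarrow> bool" where
  "Cm_on_closed m a b f \<longleftrightarrow>
     (\<forall>j<m. (deriv ^^ j) f differentiable_on {a<..<b}) \<and>
     (\<forall>j\<le>m. \<exists>g. continuous_on {a..b} g \<and> (\<forall>x\<in>{a<..<b}. g x = (deriv ^^ j) f x))"

definition Cm_norm :: "nat \<Rightarrow> real \<Rightarrow> real \<Rightarrow> (real \<Rightarrow> real) \<Rightarrow> ennreal" where
  "Cm_norm m a b f =
     (if Cm_on_closed m a b f
      then (\<Sum>j\<le>m. (SUP x\<in>{a<..<b}. ennreal \<bar>(deriv ^^ j) f x\<bar>))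
      else \<infinity>)"

end

theory Submission
  imports Defs
begin

text \<open>
  Away from the end points the equation is a small singular perturbation of \<open>U\<^sup>2 / 2 = P c\<close>, so
  solutions are expected to follow one of the two slow curves \<open>\<plusminus> sqrt (2 * P c)\<close>. After the shift
  \<open>Y = U + 2 * \<nu> * x\<close> and the change of variable \<open>x = tanh t\<close> the equation becomes
  \<open>\<nu> dY/dt = P c + 2 * \<nu>\<^sup>2 - Y\<^sup>2 / 2\<close> on the whole real line, in which the upper curve
  \<open>W = sqrt (2 * P c)\<close> attracts forward in time and repels backward in time. As \<open>chat\<close> is
  interior to \<open>J 0\<close>, for \<open>c\<close> of nearby direction the polynomial \<open>P c\<close> is bounded below by a fixed
  positive multiple of \<open>norm c\<close>, and the attraction has a uniform rate. By the reflection \<open>x \<mapsto> - x\<close>, \<open>U \<mapsto> - U\<close> only upper solutions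
  need to be studied.

  For the uniform estimate, a solution that lies more than \<open>C * \<nu>\<close> above \<open>W\<close> blows up in finite
  backward time, so \<open>Y \<le> W + C * \<nu>\<close> (\<open>riccati_upper_bound\<close>). For the opposite inequality,
  it is enough that \<open>Y\<close> exceeds a fixed level above \<open>- W\<close> at times arbitrarily far in the past: from
  there it is attracted to \<open>W\<close> well before any given time (\<open>riccati_lower_bound\<close>). If this
  failed, \<open>Y\<close> would stay below a negative constant near \<open>t = - \<infinity>\<close>, and then the linear equation for
  \<open>z\<close> that makes \<open>Y + 1 / z\<close> a solution would have a positive global solution, contradicting that
  \<open>Y\<close> is the greatest solution (\<open>greatest_solution_not_below\<close>).

  For the derivatives, \<open>D = Y - W\<close> is differentiated in \<open>x\<close>. The derivative of order \<open>j\<close> satisfies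
  \<open>\<nu> (1 - x\<^sup>2) D\<^sub>j' + (Y - 2 * j * \<nu> * x) D\<^sub>j = T\<close>, where \<open>T\<close> only involves lower orders and is
  \<open>O(\<nu>)\<close> relative to the size of \<open>W\<close>. The damping coefficient remains positive for small \<open>\<nu>\<close>, and
  the equation of order \<open>j - 1\<close> bounds \<open>(1 - x\<^sup>2) D\<^sub>j\<close>, which is far less growth at
  \<open>x = -1\<close> than that of a homogeneous solution; hence \<open>D\<^sub>j = O(\<nu>)\<close>
  (\<open>degenerate_linear_ode_bounded\<close>). How small \<open>\<nu>\<close> must be for this depends on the order.
\<close>

section \<open>Smooth functions and uniform estimates in families\<close>

primrec ndiff :: "nat \<Rightarrow> real set \<Rightarrow> (real \<Rightarrow> real) \<Rightarrow> bool" where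
  "ndiff 0 S f \<longleftrightarrow> True"
| "ndiff (Suc n) S f \<longleftrightarrow> (\<forall>x\<in>S. f field_differentiable at x) \<and> ndiff n S (deriv f)"

definition smooth_on :: "real set \<Rightarrow> (real \<Rightarrow> real) \<Rightarrow> bool" where
  "smooth_on S f \<longleftrightarrow> (\<forall>n. ndiff n S f)"

text \<open>For a family of functions \<open>f p\<close>, indexed by \<open>p \<in> \<P>\<close>, this says \<open>f p = O(w p)\<close> in \<open>C\<^sup>n\<close> norm
  on \<open>S\<close>, with one constant for the whole family. Hiding the constant behind an existential
  quantifier lets estimates be composed by rules for sums, products and quotients. The absolute
  value around \<open>w p\<close> makes these rules independent of the sign of the weight.\<close>

definition unif_O ::
  "real set \<Rightarrow> 'p set \<Rightarrow> nat \<Rightarrow> ('p \<Rightarrow> real) \<Rightarrow> ('p \<Rightarrow> real \<Rightarrow> real) \<Rightarrow> bool" where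
  "unif_O S \<P> n w f \<longleftrightarrow> (\<forall>p\<in>\<P>. smooth_on S (f p)) \<and>
     (\<exists>B. \<forall>p\<in>\<P>. \<forall>j\<le>n. \<forall>x\<in>S. \<bar>(deriv ^^ j) (f p) x\<bar> \<le> B * \<bar>w p\<bar>)"

lemma funpow_deriv_Suc: "(deriv ^^ Suc j) f = (deriv ^^ j) (deriv f)"
  by (simp add: funpow_swap1)

lemma ndiff_lower: "ndiff (Suc n) S f \<Longrightarrow> ndiff n S f"
  by (induction n arbitrary: f) auto

lemma smooth_on_imp_ndiff: "smooth_on S f \<Longrightarrow> ndiff n S f"
  by (simp add: smooth_on_def)

lemma smooth_on_deriv: "smooth_on S f \<Longrightarrow> smooth_on S (deriv f)"
  unfolding smooth_on_def by (metis ndiff.simps(2))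

lemma smooth_on_has_deriv:
  "smooth_on S f \<Longrightarrow> x \<in> S \<Longrightarrow> (f has_real_derivative deriv f x) (at x)"
  unfolding smooth_on_def DERIV_deriv_iff_field_differentiable by (metis ndiff.simps(2))

lemma smooth_on_funpow: "smooth_on S f \<Longrightarrow> smooth_on S ((deriv ^^ j) f)"
  by (induction j) (auto intro: smooth_on_deriv)

context
  fixes S :: "real set"
  assumes open_S: "open S"
begin

lemma deriv_cong_open: "(\<And>x. x \<in> S \<Longrightarrow> f x = g x) \<Longrightarrow> x \<in> S \<Longrightarrow> deriv f x = deriv g x"
  by (intro deriv_cong_ev) (auto simp: eventually_nhds intro!: exI[of _ S] open_S)

lemma funpow_deriv_cong:
  "(\<And>x. x \<in> S \<Longrightarrow> f x = g x) \<Longrightarrow> x \<in> S \<Longrightarrow> (deriv ^^ j) f x = (deriv ^^ j) g x"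
proof (induction j arbitrary: f g)
  case (Suc j)
  then show ?case unfolding funpow_deriv_Suc using deriv_cong_open[of f g] by blast
qed simp

lemma ndiff_cong: "(\<And>x. x \<in> S \<Longrightarrow> f x = g x) \<Longrightarrow> ndiff n S f \<Longrightarrow> ndiff n S g"
proof (induction n arbitrary: f g)
  case (Suc n)
  have "(g has_real_derivative deriv f x) (at x)" if "x \<in> S" for x
  proof (rule has_field_derivative_transform_within_open[OF _ open_S that])
    show "(f has_real_derivative deriv f x) (at x)"
      using Suc.prems(2) that by (simp add: DERIV_deriv_iff_field_differentiable)
  qed (use Suc.prems in auto)
  then have "\<forall>x\<in>S. g field_differentiable at x"
    by (auto simp: field_differentiable_def)
  moreover have "ndiff n S (deriv g)"
    using Suc.IH[of "deriv f" "deriv g"] deriv_cong_open[of f g] Suc.prems by simp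
  ultimately show ?case by simp
qed simp

lemma ndiff_SucI:
  assumes "\<And>x. x \<in> S \<Longrightarrow> (f has_real_derivative g x) (at x)" and "ndiff n S g"
  shows "ndiff (Suc n) S f"
proof -
  have "ndiff n S (deriv f)"
    by (rule ndiff_cong[OF _ assms(2)]) (simp add: DERIV_imp_deriv[OF assms(1)])
  then show ?thesis using assms(1) by (auto simp: field_differentiable_def)
qed

lemma ndiff_has_deriv:
  "ndiff (Suc n) S f \<Longrightarrow> x \<in> S \<Longrightarrow> (f has_real_derivative deriv f x) (at x)"
  by (simp add: DERIV_deriv_iff_field_differentiable)

lemma ndiff_const: "ndiff n S (\<lambda>x. a)"
  by (induction n arbitrary: a)
    (simp, rule ndiff_SucI[of _ "\<lambda>x. 0"], auto)

lemma ndiff_ident: "ndiff n S (\<lambda>x. x)"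
  by (cases n) (simp, auto intro!: ndiff_SucI[of _ "\<lambda>x. 1"] ndiff_const simp del: ndiff.simps)

lemma ndiff_add: "ndiff n S f \<Longrightarrow> ndiff n S g \<Longrightarrow> ndiff n S (\<lambda>x. f x + g x)"
proof (induction n arbitrary: f g)
  case (Suc n)
  show ?case
    by (rule ndiff_SucI[where g = "\<lambda>x. deriv f x + deriv g x"])
      (use Suc in \<open>auto intro!: derivative_eq_intros ndiff_has_deriv simp del: ndiff.simps(2)\<close>, use Suc in auto)
qed simp

lemma ndiff_mult: "ndiff n S f \<Longrightarrow> ndiff n S g \<Longrightarrow> ndiff n S (\<lambda>x. f x * g x)"
proof (induction n arbitrary: f g)
  case (Suc n)
  have d: "((\<lambda>x. f x * g x) has_real_derivative deriv f x * g x + f x * deriv g x) (at x)"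
    if "x \<in> S" for x
    using ndiff_has_deriv[OF Suc.prems(1) that] ndiff_has_deriv[OF Suc.prems(2) that]
    by (auto intro!: derivative_eq_intros)
  show ?case
    by (rule ndiff_SucI[OF d]) (use Suc ndiff_lower in \<open>auto intro!: ndiff_add\<close>)
qed simp

lemma ndiff_inverse:
  "ndiff n S f \<Longrightarrow> (\<And>x. x \<in> S \<Longrightarrow> f x \<noteq> 0) \<Longrightarrow> ndiff n S (\<lambda>x. inverse (f x))"
proof (induction n)
  case (Suc n)
  have d: "((\<lambda>x. inverse (f x)) has_real_derivative
      (-1) * deriv f x * (inverse (f x) * inverse (f x))) (at x)" if "x \<in> S" for x
    using ndiff_has_deriv[OF Suc.prems(1) that] Suc.prems(2)[OF that]
    by (auto intro!: derivative_eq_intros simp: power2_eq_square)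
  have "ndiff n S f" "ndiff n S (deriv f)" using Suc.prems(1) ndiff_lower by auto
  then have "ndiff n S (\<lambda>x. (-1) * deriv f x * (inverse (f x) * inverse (f x)))"
    using Suc.IH Suc.prems(2) by (intro ndiff_mult ndiff_const) auto
  then show ?case using ndiff_SucI[OF d] by blast
qed simp

lemma smooth_on_cong: "(\<And>x. x \<in> S \<Longrightarrow> f x = g x) \<Longrightarrow> smooth_on S f \<Longrightarrow> smooth_on S g"
  using ndiff_cong unfolding smooth_on_def by blast

lemma smooth_on_const: "smooth_on S (\<lambda>x. a)"
  and smooth_on_ident: "smooth_on S (\<lambda>x. x)"
  and smooth_on_add: "smooth_on S f \<Longrightarrow> smooth_on S g \<Longrightarrow> smooth_on S (\<lambda>x. f x + g x)"
  and smooth_on_mult: "smooth_on S f \<Longrightarrow> smooth_on S g \<Longrightarrow> smooth_on S (\<lambda>x. f x * g x)"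
  and smooth_on_inverse: "smooth_on S f \<Longrightarrow> (\<And>x. x \<in> S \<Longrightarrow> f x \<noteq> 0) \<Longrightarrow>
    smooth_on S (\<lambda>x. inverse (f x))"
  by (simp_all add: smooth_on_def ndiff_const ndiff_ident ndiff_add ndiff_mult ndiff_inverse)

lemma smooth_on_diff:
  assumes "smooth_on S f" "smooth_on S g" shows "smooth_on S (\<lambda>x. f x - g x)"
  using smooth_on_add[OF assms(1) smooth_on_mult[OF smooth_on_const[of "-1"] assms(2)]] by simp

text \<open>The bootstrap for differential equations: when the derivative of \<open>f\<close> is an expression in \<open>f\<close>
  itself that is as differentiable as \<open>f\<close> is, each round gains one derivative.\<close>

lemma smooth_on_induct:
  assumes "\<And>x. x \<in> S \<Longrightarrow> (f has_real_derivative g x) (at x)"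
    and "\<And>n. ndiff n S f \<Longrightarrow> ndiff n S g"
  shows "smooth_on S f"
  unfolding smooth_on_def
proof
  show "ndiff n S f" for n
    by (induction n) (simp, rule ndiff_SucI[OF assms(1)], use assms(2) in auto)
qed

lemma deriv_add_on:
  "smooth_on S f \<Longrightarrow> smooth_on S g \<Longrightarrow> x \<in> S \<Longrightarrow>
    deriv (\<lambda>x. f x + g x) x = deriv f x + deriv g x"
  by (intro DERIV_imp_deriv DERIV_add smooth_on_has_deriv)

lemma deriv_mult_on:
  "smooth_on S f \<Longrightarrow> smooth_on S g \<Longrightarrow> x \<in> S \<Longrightarrow>
    deriv (\<lambda>x. f x * g x) x = deriv f x * g x + f x * deriv g x"
  using DERIV_mult[OF smooth_on_has_deriv[of S f x] smooth_on_has_deriv[of S g x]]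
  by (auto intro!: DERIV_imp_deriv simp: algebra_simps)

lemma unif_O_smooth: "unif_O S \<P> n w f \<Longrightarrow> p \<in> \<P> \<Longrightarrow> smooth_on S (f p)"
  by (simp add: unif_O_def)

lemma unif_O_boundE:
  assumes "unif_O S \<P> n w f"
  obtains B where "B \<ge> 0"
    "\<And>p j x. p \<in> \<P> \<Longrightarrow> j \<le> n \<Longrightarrow> x \<in> S \<Longrightarrow> \<bar>(deriv ^^ j) (f p) x\<bar> \<le> B * \<bar>w p\<bar>"
proof -
  obtain B where B: "\<forall>p\<in>\<P>. \<forall>j\<le>n. \<forall>x\<in>S. \<bar>(deriv ^^ j) (f p) x\<bar> \<le> B * \<bar>w p\<bar>"
    using assms unfolding unif_O_def by blast
  have "B * \<bar>w p\<bar> \<le> max 0 B * \<bar>w p\<bar>" for p by (intro mult_right_mono) auto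
  then show ?thesis using B by (intro that[of "max 0 B"]) (simp, meson order_trans)
qed

lemma unif_O_I:
  assumes "\<And>p. p \<in> \<P> \<Longrightarrow> smooth_on S (f p)"
    and "\<And>p j x. p \<in> \<P> \<Longrightarrow> j \<le> n \<Longrightarrow> x \<in> S \<Longrightarrow> \<bar>(deriv ^^ j) (f p) x\<bar> \<le> B * \<bar>w p\<bar>"
  shows "unif_O S \<P> n w f"
  using assms unfolding unif_O_def by blast

lemma unif_O_cong:
  assumes "\<And>p x. p \<in> \<P> \<Longrightarrow> x \<in> S \<Longrightarrow> f p x = g p x" and "unif_O S \<P> n w f"
  shows "unif_O S \<P> n w g"
proof -
  obtain B where B: "\<And>p j x. p \<in> \<P> \<Longrightarrow> j \<le> n \<Longrightarrow> x \<in> S \<Longrightarrow> \<bar>(deriv ^^ j) (f p) x\<bar> \<le> B * \<bar>w p\<bar>"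
    using unif_O_boundE[OF assms(2)] by metis
  show ?thesis
  proof (rule unif_O_I)
    show "smooth_on S (g p)" if "p \<in> \<P>" for p
      using smooth_on_cong[of "f p"] assms(1) unif_O_smooth[OF assms(2) that] that by blast
    show "\<bar>(deriv ^^ j) (g p) x\<bar> \<le> B * \<bar>w p\<bar>" if "p \<in> \<P>" "j \<le> n" "x \<in> S" for p j x
      using B[OF that] funpow_deriv_cong[of "f p" "g p" x j] assms(1) that by simp
  qed
qed

lemma unif_O_lower: "unif_O S \<P> n w f \<Longrightarrow> k \<le> n \<Longrightarrow> unif_O S \<P> k w f"
  unfolding unif_O_def by (meson le_trans)

lemma unif_O_weight:
  assumes "unif_O S \<P> n w f" and "\<And>p. p \<in> \<P> \<Longrightarrow> \<bar>w p\<bar> \<le> K * \<bar>v p\<bar>"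
  shows "unif_O S \<P> n v f"
proof -
  obtain B where B: "B \<ge> 0"
    "\<And>p j x. p \<in> \<P> \<Longrightarrow> j \<le> n \<Longrightarrow> x \<in> S \<Longrightarrow> \<bar>(deriv ^^ j) (f p) x\<bar> \<le> B * \<bar>w p\<bar>"
    using unif_O_boundE[OF assms(1)] by metis
  have "B * \<bar>w p\<bar> \<le> (B * K) * \<bar>v p\<bar>" if "p \<in> \<P>" for p
    using mult_left_mono[OF assms(2)[OF that] B(1)] by (simp add: mult.assoc)
  then show ?thesis
    using B(2) unif_O_smooth[OF assms(1)]
    by (intro unif_O_I[where B = "B * K"]) (simp, meson order_trans)
qed

lemma unif_O_SucI:
  assumes "unif_O S \<P> 0 w f" and "unif_O S \<P> n w (\<lambda>p. deriv (f p))"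
  shows "unif_O S \<P> (Suc n) w f"
proof -
  obtain A where A: "A \<ge> 0"
    "\<And>p j x. p \<in> \<P> \<Longrightarrow> j \<le> 0 \<Longrightarrow> x \<in> S \<Longrightarrow> \<bar>(deriv ^^ j) (f p) x\<bar> \<le> A * \<bar>w p\<bar>"
    using unif_O_boundE[OF assms(1)] by metis
  obtain B where B: "B \<ge> 0"
    "\<And>p j x. p \<in> \<P> \<Longrightarrow> j \<le> n \<Longrightarrow> x \<in> S \<Longrightarrow> \<bar>(deriv ^^ j) (deriv (f p)) x\<bar> \<le> B * \<bar>w p\<bar>"
    using unif_O_boundE[OF assms(2)] by metis
  have m: "A * \<bar>w p\<bar> \<le> max A B * \<bar>w p\<bar>" "B * \<bar>w p\<bar> \<le> max A B * \<bar>w p\<bar>" for p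
    by (auto intro: mult_right_mono)
  show ?thesis
  proof (rule unif_O_I[where B = "max A B"])
    show "\<bar>(deriv ^^ j) (f p) x\<bar> \<le> max A B * \<bar>w p\<bar>"
      if "p \<in> \<P>" "j \<le> Suc n" "x \<in> S" for p j x
    proof (cases j)
      case 0
      then show ?thesis using A(2)[of p 0 x] m(1)[of p] that by simp
    next
      case (Suc i)
      then show ?thesis using B(2)[of p i x] m(2)[of p] that by (simp add: funpow_swap1)
    qed
  qed (use unif_O_smooth[OF assms(1)] in auto)
qed

lemma unif_O_deriv:
  assumes "unif_O S \<P> (Suc n) w f"
  shows "unif_O S \<P> n w (\<lambda>p. deriv (f p))"
proof -
  obtain B where B: "\<And>p j x. p \<in> \<P> \<Longrightarrow> j \<le> Suc n \<Longrightarrow> x \<in> S \<Longrightarrow> \<bar>(deriv ^^ j) (f p) x\<bar> \<le> B * \<bar>w p\<bar>"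
    using unif_O_boundE[OF assms] by metis
  show ?thesis
  proof (rule unif_O_I[where B = B])
    show "smooth_on S (deriv (f p))" if "p \<in> \<P>" for p
      by (rule smooth_on_deriv[OF unif_O_smooth[OF assms that]])
    show "\<bar>(deriv ^^ j) (deriv (f p)) x\<bar> \<le> B * \<bar>w p\<bar>"
      if "p \<in> \<P>" "j \<le> n" "x \<in> S" for p j x
      using B[of p "Suc j" x] that unfolding funpow_deriv_Suc by simp
  qed
qed

lemma unif_O_funpow:
  "unif_O S \<P> (n + j) w f \<Longrightarrow> unif_O S \<P> n w (\<lambda>p. (deriv ^^ j) (f p))"
proof (induction j arbitrary: n)
  case (Suc j)
  then have "unif_O S \<P> (Suc n) w (\<lambda>p. (deriv ^^ j) (f p))" by simp
  then show ?case using unif_O_deriv by fastforce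
qed simp

lemma unif_O_add:
  "unif_O S \<P> n w f \<Longrightarrow> unif_O S \<P> n w g \<Longrightarrow> unif_O S \<P> n w (\<lambda>p x. f p x + g p x)"
proof (induction n arbitrary: f g)
  case 0
  obtain A where A: "\<And>p j x. p \<in> \<P> \<Longrightarrow> j \<le> 0 \<Longrightarrow> x \<in> S \<Longrightarrow> \<bar>(deriv ^^ j) (f p) x\<bar> \<le> A * \<bar>w p\<bar>"
    using unif_O_boundE[OF 0(1)] by metis
  obtain B where B: "\<And>p j x. p \<in> \<P> \<Longrightarrow> j \<le> 0 \<Longrightarrow> x \<in> S \<Longrightarrow> \<bar>(deriv ^^ j) (g p) x\<bar> \<le> B * \<bar>w p\<bar>"
    using unif_O_boundE[OF 0(2)] by metis
  show ?case
  proof (rule unif_O_I[where B = "A + B"])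
    show "smooth_on S (\<lambda>x. f p x + g p x)" if "p \<in> \<P>" for p
      by (intro smooth_on_add unif_O_smooth[OF 0(1) that] unif_O_smooth[OF 0(2) that])
    show "\<bar>(deriv ^^ j) (\<lambda>x. f p x + g p x) x\<bar> \<le> (A + B) * \<bar>w p\<bar>"
      if "p \<in> \<P>" "j \<le> 0" "x \<in> S" for p j x
      using A[OF that] B[OF that] that by (simp add: distrib_right)
  qed
next
  case (Suc n)
  show ?case
  proof (rule unif_O_SucI)
    have "unif_O S \<P> n w (\<lambda>p x. deriv (f p) x + deriv (g p) x)"
      by (intro Suc.IH unif_O_deriv Suc.prems)
    then show "unif_O S \<P> n w (\<lambda>p. deriv (\<lambda>x. f p x + g p x))"
    proof (rule unif_O_cong[rotated])
      fix p x assume p: "p \<in> \<P>" "x \<in> S"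
      show "deriv (f p) x + deriv (g p) x = deriv (\<lambda>x. f p x + g p x) x"
        using deriv_add_on[OF unif_O_smooth[OF Suc.prems(1) p(1)] unif_O_smooth[OF Suc.prems(2) p(1)] p(2)]
        by simp
    qed
    have "unif_O S \<P> n w (\<lambda>p x. f p x + g p x)"
      by (intro Suc.IH unif_O_lower[OF Suc.prems(1)] unif_O_lower[OF Suc.prems(2)]) auto
    then show "unif_O S \<P> 0 w (\<lambda>p x. f p x + g p x)" by (rule unif_O_lower) simp
  qed
qed

lemma unif_O_mult:
  "unif_O S \<P> n v f \<Longrightarrow> unif_O S \<P> n w g \<Longrightarrow>
    unif_O S \<P> n (\<lambda>p. v p * w p) (\<lambda>p x. f p x * g p x)"
proof (induction n arbitrary: f g)
  case 0
  obtain A where A: "A \<ge> 0" "\<And>p j x. p \<in> \<P> \<Longrightarrow> j \<le> 0 \<Longrightarrow> x \<in> S \<Longrightarrow> \<bar>(deriv ^^ j) (f p) x\<bar> \<le> A * \<bar>v p\<bar>"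
    using unif_O_boundE[OF 0(1)] by metis
  obtain B where B: "\<And>p j x. p \<in> \<P> \<Longrightarrow> j \<le> 0 \<Longrightarrow> x \<in> S \<Longrightarrow> \<bar>(deriv ^^ j) (g p) x\<bar> \<le> B * \<bar>w p\<bar>"
    using unif_O_boundE[OF 0(2)] by metis
  show ?case
  proof (rule unif_O_I[where B = "A * B"])
    show "smooth_on S (\<lambda>x. f p x * g p x)" if "p \<in> \<P>" for p
      by (intro smooth_on_mult unif_O_smooth[OF 0(1) that] unif_O_smooth[OF 0(2) that])
    show "\<bar>(deriv ^^ j) (\<lambda>x. f p x * g p x) x\<bar> \<le> (A * B) * \<bar>v p * w p\<bar>"
      if "p \<in> \<P>" "j \<le> 0" "x \<in> S" for p j x
      using mult_mono[OF A(2)[OF that] B[OF that]] A(1) that by (simp add: abs_mult algebra_simps)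
  qed
next
  case (Suc n)
  have l: "unif_O S \<P> n v f" "unif_O S \<P> n w g"
    by (rule unif_O_lower[OF Suc.prems(1)], simp, rule unif_O_lower[OF Suc.prems(2)], simp)
  show ?case
  proof (rule unif_O_SucI)
    have "unif_O S \<P> n (\<lambda>p. v p * w p) (\<lambda>p x. deriv (f p) x * g p x + f p x * deriv (g p) x)"
      by (intro unif_O_add Suc.IH l unif_O_deriv Suc.prems)
    then show "unif_O S \<P> n (\<lambda>p. v p * w p) (\<lambda>p. deriv (\<lambda>x. f p x * g p x))"
    proof (rule unif_O_cong[rotated])
      fix p x assume p: "p \<in> \<P>" "x \<in> S"
      show "deriv (f p) x * g p x + f p x * deriv (g p) x = deriv (\<lambda>x. f p x * g p x) x"
        using deriv_mult_on[OF unif_O_smooth[OF Suc.prems(1) p(1)] unif_O_smooth[OF Suc.prems(2) p(1)] p(2)]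
        by simp
    qed
    show "unif_O S \<P> 0 (\<lambda>p. v p * w p) (\<lambda>p x. f p x * g p x)"
      by (rule unif_O_lower[OF Suc.IH[OF l]]) simp
  qed
qed

lemma unif_O_const:
  assumes "\<And>p. p \<in> \<P> \<Longrightarrow> \<bar>a p\<bar> \<le> K * \<bar>w p\<bar>"
  shows "unif_O S \<P> n w (\<lambda>p x. a p)"
proof (rule unif_O_I)
  have d: "(deriv ^^ j) (\<lambda>x. b) = (if j = 0 then (\<lambda>x. b) else (\<lambda>x. 0))" for b :: real and j
  proof (induction j)
    case (Suc j)
    then show ?case by (cases j) auto
  qed simp
  have "0 \<le> K * \<bar>w p\<bar>" if "p \<in> \<P>" for p using assms[OF that] by linarith
  then show "\<bar>(deriv ^^ j) (\<lambda>x. a p) x\<bar> \<le> K * \<bar>w p\<bar>" if "p \<in> \<P>" for p j x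
    using assms[OF that] that by (auto simp: d)
qed (rule smooth_on_const)

lemma unif_O_diff:
  assumes "unif_O S \<P> n w f" "unif_O S \<P> n w g"
  shows "unif_O S \<P> n w (\<lambda>p x. f p x - g p x)"
proof -
  have "unif_O S \<P> n w (\<lambda>p x. (-1) * g p x)"
    using unif_O_mult[OF unif_O_const[of \<P> "\<lambda>p. -1" 1 "\<lambda>p. 1" n] assms(2)] by simp
  then show ?thesis using unif_O_add[OF assms(1)] by fastforce
qed

text \<open>The lower bound keeps \<open>f p\<close> comparable to its weight, so that \<open>f' / f\<^sup>2\<close> has the size
  \<open>w / w\<^sup>2\<close> and the induction on the order closes.\<close>

lemma unif_O_inverse:
  assumes "unif_O S \<P> n w f" and "d > 0"
    and "\<And>p. p \<in> \<P> \<Longrightarrow> w p > 0"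
    and "\<And>p x. p \<in> \<P> \<Longrightarrow> x \<in> S \<Longrightarrow> f p x \<ge> d * w p"
  shows "unif_O S \<P> n (\<lambda>p. inverse (w p)) (\<lambda>p x. inverse (f p x))"
proof -
  have pos: "f p x > 0" if "p \<in> \<P>" "x \<in> S" for p x
    using assms(3)[OF that(1)] assms(4)[OF that] assms(2) by (smt (verit) mult_pos_pos)
  show ?thesis
    using assms(1)
  proof (induction n)
    have sm: "smooth_on S (\<lambda>x. inverse (f p x))" if "p \<in> \<P>" for p
      using smooth_on_inverse[OF unif_O_smooth[OF assms(1) that]] pos[OF that]
      by (metis less_irrefl)
    case 0
    show ?case
    proof (rule unif_O_I[where B = "inverse d"])
      show "\<bar>(deriv ^^ j) (\<lambda>x. inverse (f p x)) x\<bar> \<le> inverse d * \<bar>inverse (w p)\<bar>"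
        if "p \<in> \<P>" "j \<le> 0" "x \<in> S" for p j x
      proof -
        have "inverse (f p x) \<le> inverse (d * w p)"
          using that assms by (intro le_imp_inverse_le) auto
        then show ?thesis using pos[of p x] assms(3)[of p] that by (simp add: inverse_mult_distrib)
      qed
    qed (fact sm)
  next
    case (Suc n)
    have IH: "unif_O S \<P> n (\<lambda>p. inverse (w p)) (\<lambda>p x. inverse (f p x))"
      using Suc.IH unif_O_lower[OF Suc.prems] by simp
    have "unif_O S \<P> n (\<lambda>p. 1 * w p * (inverse (w p) * inverse (w p)))
        (\<lambda>p x. (-1) * deriv (f p) x * (inverse (f p x) * inverse (f p x)))"
      by (intro unif_O_mult IH unif_O_deriv[OF Suc.prems] unif_O_const[where K=1]) auto
    then have "unif_O S \<P> n (\<lambda>p. inverse (w p))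
        (\<lambda>p x. (-1) * deriv (f p) x * (inverse (f p x) * inverse (f p x)))"
      by (rule unif_O_weight[where K = 1]) (use assms(3) in \<open>auto simp: field_simps\<close>)
    then have "unif_O S \<P> n (\<lambda>p. inverse (w p)) (\<lambda>p. deriv (\<lambda>x. inverse (f p x)))"
    proof (rule unif_O_cong[rotated])
      fix p x assume p: "p \<in> \<P>" "x \<in> S"
      have "((\<lambda>x. inverse (f p x)) has_real_derivative
        (-1) * deriv (f p) x * (inverse (f p x) * inverse (f p x))) (at x)"
        using smooth_on_has_deriv[OF unif_O_smooth[OF assms(1) p(1)] p(2)] pos[OF p]
        by (auto intro!: derivative_eq_intros simp: power2_eq_square)
      then show "(-1) * deriv (f p) x * (inverse (f p x) * inverse (f p x)) =
          deriv (\<lambda>x. inverse (f p x)) x"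
        by (metis DERIV_imp_deriv)
    qed
    then show ?case
      by (intro unif_O_SucI unif_O_lower[OF IH]) auto
  qed
qed

end

lemma unif_O_ident: "unif_O {-1<..<1} \<P> n (\<lambda>p. 1) (\<lambda>p x. x)"
proof -
  have z: "unif_O {-1<..<1} \<P> 0 (\<lambda>p. 1) (\<lambda>p x. x)"
    by (rule unif_O_I[OF _ smooth_on_ident, where B = 1]) auto
  show ?thesis
  proof (cases n)
    case (Suc k)
    show ?thesis unfolding Suc
      by (rule unif_O_SucI[OF _ z]) (auto intro!: unif_O_const[where K = 1])
  qed (use z in simp)
qed

text \<open>From \<open>W' = f' / (2 * W)\<close> for \<open>W = sqrt f\<close>, a bound of order \<open>n\<close> on \<open>W\<close> yields one of order
  \<open>n + 1\<close>; the same identity gives smoothness.\<close>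

lemma unif_O_sqrt:
  assumes "open S" and f: "\<And>n. unif_O S \<P> n (\<lambda>p. (s p)\<^sup>2) f"
    and s: "\<And>p. p \<in> \<P> \<Longrightarrow> s p > 0" and "d > 0"
    and low: "\<And>p x. p \<in> \<P> \<Longrightarrow> x \<in> S \<Longrightarrow> sqrt (f p x) \<ge> d * s p"
  shows "unif_O S \<P> n s (\<lambda>p x. sqrt (f p x))"
proof (induction n)
  have W: "sqrt (f p x) > 0" if "p \<in> \<P>" "x \<in> S" for p x
    using low[OF that] mult_pos_pos[OF \<open>d > 0\<close> s[OF that(1)]] by linarith
  have dW: "((\<lambda>x. sqrt (f p x)) has_real_derivative
      1 / 2 * deriv (f p) x * inverse (sqrt (f p x))) (at x)" if "p \<in> \<P>" "x \<in> S" for p x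
    using smooth_on_has_deriv[OF unif_O_smooth[OF assms(1) f that(1)] that(2)] W[OF that]
    by (auto intro!: derivative_eq_intros simp: field_simps)
  have sm: "smooth_on S (\<lambda>x. sqrt (f p x))" if "p \<in> \<P>" for p
  proof (rule smooth_on_induct[OF assms(1) dW[OF that]])
    fix n assume n: "ndiff n S (\<lambda>x. sqrt (f p x))"
    have "ndiff n S (\<lambda>x. 1 / 2)" by (rule ndiff_const[OF assms(1)])
    moreover have "ndiff n S (deriv (f p))"
      by (intro smooth_on_imp_ndiff smooth_on_deriv unif_O_smooth[OF assms(1) f that])
    moreover have "ndiff n S (\<lambda>x. inverse (sqrt (f p x)))"
      by (rule ndiff_inverse[OF assms(1) n]) (use W[OF that] in force)
    ultimately show "ndiff n S (\<lambda>x. 1 / 2 * deriv (f p) x * inverse (sqrt (f p x)))"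
      by (intro ndiff_mult[OF assms(1)])
  qed
  case 0
  obtain B where B: "B \<ge> 0" "\<And>p j x. p \<in> \<P> \<Longrightarrow> j \<le> 0 \<Longrightarrow> x \<in> S \<Longrightarrow>
      \<bar>(deriv ^^ j) (f p) x\<bar> \<le> B * \<bar>(s p)\<^sup>2\<bar>"
    using unif_O_boundE[OF assms(1) f] by metis
  show ?case
  proof (rule unif_O_I[OF assms(1) sm, where B = "sqrt B"])
    fix p j x assume p: "p \<in> \<P>" "j \<le> (0::nat)" "x \<in> S"
    have "sqrt (f p x) \<le> sqrt (B * (s p)\<^sup>2)"
      using B(2)[OF p] p by simp
    then show "\<bar>(deriv ^^ j) (\<lambda>x. sqrt (f p x)) x\<bar> \<le> sqrt B * \<bar>s p\<bar>"
      using W[OF p(1,3)] p by (simp add: real_sqrt_mult)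
  qed
  case (Suc n)
  have "unif_O S \<P> n (\<lambda>p. 1 * (s p)\<^sup>2 * inverse (s p))
      (\<lambda>p x. 1 / 2 * deriv (f p) x * inverse (sqrt (f p x)))"
    by (intro unif_O_mult[OF assms(1)] unif_O_const[OF assms(1), where K = 1]
        unif_O_deriv[OF assms(1)] f unif_O_inverse[OF assms(1) Suc \<open>d > 0\<close> s low]) auto
  then have "unif_O S \<P> n s (\<lambda>p x. 1 / 2 * deriv (f p) x * inverse (sqrt (f p x)))"
    by (rule unif_O_weight[OF assms(1), where K = 1]) (use s in \<open>force simp: power2_eq_square\<close>)
  then have "unif_O S \<P> n s (\<lambda>p. deriv (\<lambda>x. sqrt (f p x)))"
    by (rule unif_O_cong[OF assms(1), rotated]) (simp add: DERIV_imp_deriv[OF dW])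
  then show ?case by (intro unif_O_SucI[OF assms(1)] unif_O_lower[OF assms(1) Suc]) auto
qed

lemma DERIV_unique_on_open:
  assumes "open S" "\<And>x. x \<in> S \<Longrightarrow> f x = g x" "x \<in> S"
    and "(f has_real_derivative a) (at x)" "(g has_real_derivative b) (at x)"
  shows "a = b"
  using has_field_derivative_transform_within_open[OF assms(4,1,3,2)] assms(5)
    DERIV_unique by blast

section \<open>Differential inequalities on the real line\<close>

text \<open>Backward persistence: read from \<open>b\<close> towards \<open>a\<close>, the function \<open>E\<close> cannot decrease as long as it
  is positive, hence it never reaches zero and the monotonicity holds on the whole interval. Most
  comparison arguments below go backward in time because the solutions to be controlled are the
  ones that are repelled in backward time.\<close>

lemma positive_part_antimono:
  fixes E :: "real \<Rightarrow> real"
  assumes "a \<le> b" and "E b > 0"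
    and d: "\<And>x. a \<le> x \<Longrightarrow> x \<le> b \<Longrightarrow> (E has_real_derivative E' x) (at x)"
    and neg: "\<And>x. a \<le> x \<Longrightarrow> x \<le> b \<Longrightarrow> E x > 0 \<Longrightarrow> E' x \<le> 0"
  shows "E b \<le> E a"
proof -
  have cont: "continuous_on {a..b} E"
    by (rule DERIV_atLeastAtMost_imp_continuous_on) (use d in blast)
  have mono: "E b \<le> E x" if "a \<le> x" "x \<le> b" "\<And>y. x < y \<Longrightarrow> y \<le> b \<Longrightarrow> E y > 0" for x
  proof (rule DERIV_nonpos_imp_decreasing_open[OF that(2)])
    show "\<exists>y. (E has_real_derivative y) (at z) \<and> y \<le> 0" if "x < z" "z < b" for z
      using d[of z] neg[of z] \<open>\<And>y. x < y \<Longrightarrow> y \<le> b \<Longrightarrow> E y > 0\<close>[of z] that \<open>a \<le> x\<close> by auto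
    show "continuous_on {x..b} E" using cont by (rule continuous_on_subset) (use that in auto)
  qed
  show ?thesis
  proof (cases "\<exists>x\<in>{a..b}. E x \<le> 0")
    case True
    define Z where "Z = {x\<in>{a..b}. E x \<le> 0}"
    have "closed Z" unfolding Z_def
      by (rule continuous_on_closed_Collect_le[OF cont continuous_on_const closed_atLeastAtMost])
    moreover have "bounded Z"
      by (rule bounded_subset[OF bounded_closed_interval[of a b]]) (auto simp: Z_def)
    ultimately have "compact Z" by (simp add: compact_eq_bounded_closed)
    moreover have "Z \<noteq> {}" using True by (auto simp: Z_def)
    ultimately obtain s where s: "s \<in> Z" "\<And>y. y \<in> Z \<Longrightarrow> y \<le> s"
      using compact_attains_sup by metis
    have s': "a \<le> s" "s \<le> b" "E s \<le> 0" using s(1) by (auto simp: Z_def)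
    have "E y > 0" if "s < y" "y \<le> b" for y
    proof (rule ccontr)
      assume "\<not> E y > 0"
      then have "y \<in> Z" using that s' by (simp add: Z_def)
      then show False using s(2)[of y] that by simp
    qed
    then have "E b \<le> E s" using mono s' by blast
    then show ?thesis using s(1) \<open>E b > 0\<close> by (simp add: Z_def)
  next
    case False
    then have "E y > 0" if "a < y" "y \<le> b" for y
      using that by (metis atLeastAtMost_iff less_imp_le not_le)
    then show ?thesis using mono[of a] \<open>a \<le> b\<close> by blast
  qed
qed

text \<open>If \<open>G\<close> exceeded \<open>c\<close> somewhere, then, followed backward, it would stay above \<open>c\<close>, and
  \<open>1 / G\<close> would decrease at rate at least \<open>k\<close>. It would become negative after the finite time
  \<open>1 / (k * G t)\<close>, although \<open>G\<close> is positive and defined on the whole line.\<close>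

lemma no_backward_global_riccati:
  fixes G :: "real \<Rightarrow> real"
  assumes "k > 0" and c: "c \<ge> 0"
    and d: "\<And>t. (G has_real_derivative G' t) (at t)"
    and neg: "\<And>t. G t > c \<Longrightarrow> G' t \<le> - k * (G t)\<^sup>2"
  shows "G t \<le> c"
proof (rule ccontr)
  assume "\<not> G t \<le> c"
  then have Gt: "G t > c" by simp
  have above: "G s \<ge> G t" if "s \<le> t" for s
  proof -
    have n: "G' u \<le> 0" if "G u > c" for u
      using neg[OF that] \<open>k > 0\<close> by (smt (verit) mult_nonneg_nonneg zero_le_power2 mult_minus_left)
    have dc: "((\<lambda>u. G u - c) has_real_derivative G' u) (at u)" for u
      using DERIV_diff[OF d[of u] DERIV_const[of c]] by simp
    have "G t - c \<le> G s - c"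
      by (rule positive_part_antimono[OF that _ dc]) (use Gt n in auto)
    then show ?thesis by simp
  qed
  define s where "s = t - 1 / (k * G t)"
  have Gpos: "G u > 0" if "u \<le> t" for u using above[OF that] Gt c by linarith
  have "s \<le> t" using Gpos[of t] \<open>k > 0\<close> by (simp add: s_def)
  have "inverse (G s) - k * s \<le> inverse (G t) - k * t"
  proof (rule DERIV_nonneg_imp_nondecreasing[OF \<open>s \<le> t\<close>])
    fix u assume u: "s \<le> u" "u \<le> t"
    have "((\<lambda>u. inverse (G u) - k * u) has_real_derivative
        - (inverse (G u) * G' u * inverse (G u)) - k) (at u)"
      using Gpos[of u] u
      by (intro DERIV_diff DERIV_inverse' DERIV_cmult_Id d) auto
    moreover have "0 \<le> - (inverse (G u) * G' u * inverse (G u)) - k"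
      using neg[of u] above[of u] Gt u Gpos[of u]
      by (auto simp: field_simps power2_eq_square)
    ultimately show "\<exists>y. ((\<lambda>u. inverse (G u) - k * u) has_real_derivative y) (at u) \<and> 0 \<le> y"
      by blast
  qed
  moreover have "k * (t - s) = inverse (G t)"
    using \<open>k > 0\<close> Gpos[of t] by (simp add: s_def field_simps)
  ultimately have "inverse (G s) \<le> 0" by (simp add: algebra_simps)
  then show False using Gpos[OF \<open>s \<le> t\<close>] by simp
qed

text \<open>Solutions of the homogeneous equation grow at least like \<open>exp (- 4 * t)\<close> in backward time, since
  \<open>a t / \<nu> \<ge> 4\<close>. A solution that grows at most like \<open>exp (- 2 * t)\<close> has no such component, and what
  is left is bounded by the forcing divided by the damping.\<close>

lemma linear_ode_bounded_side:
  fixes Z :: "real \<Rightarrow> real"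
  assumes \<nu>: "\<nu> > 0" and \<alpha>: "\<alpha> \<ge> 4 * \<nu>"
    and d: "\<And>t. (Z has_real_derivative Z' t) (at t)"
    and eq: "\<And>t. \<nu> * Z' t + a t * Z t = f t"
    and a: "\<And>t. a t \<ge> \<alpha>" and f: "\<And>t. f t \<le> F" and "F \<ge> 0"
    and growth: "\<And>t. t \<le> 0 \<Longrightarrow> Z t \<le> B * exp (- 2 * t)"
  shows "Z t \<le> F / \<alpha>"
proof (rule ccontr)
  assume "\<not> Z t \<le> F / \<alpha>"
  \<comment> \<open>The factor \<open>exp (4 * u)\<close> is chosen between the two rates: \<open>E\<close> is decreasing where it is
    positive, and the growth bound forces it to tend to zero at \<open>- \<infinity>\<close>.\<close>
  define E where "E u = (Z u - F / \<alpha>) * exp (4 * u)" for u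
  define E' where "E' u = Z' u * exp (4 * u) + (Z u - F / \<alpha>) * (exp (4 * u) * 4)" for u
  have \<alpha>0: "\<alpha> > 0" using \<nu> \<alpha> by linarith
  have pos: "E t > 0" using \<open>\<not> Z t \<le> F / \<alpha>\<close> by (simp add: E_def)
  have dE: "(E has_real_derivative E' u) (at u)" for u
    unfolding E_def E'_def by (auto intro!: derivative_eq_intros d)
  have neg: "E' u \<le> 0" if "E u > 0" for u
  proof -
    let ?e = "Z u - F / \<alpha>"
    have e: "?e > 0" using that by (simp add: E_def zero_less_mult_iff)
    have "\<nu> * Z' u = f u - a u * Z u" using eq[of u] by simp
    also have "\<dots> \<le> F - \<alpha> * Z u"
    proof -
      have "Z u \<ge> 0" using e \<open>F \<ge> 0\<close> \<alpha>0 by (smt (verit) divide_nonneg_pos)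
      then have "\<alpha> * Z u \<le> a u * Z u" by (intro mult_right_mono a)
      then show ?thesis using f[of u] by linarith
    qed
    also have "\<dots> = - \<alpha> * ?e" using \<alpha>0 by (simp add: field_simps)
    also have "\<dots> \<le> - (4 * \<nu>) * ?e" using \<alpha> e by (intro mult_right_mono) auto
    finally have "\<nu> * (Z' u + 4 * ?e) \<le> 0" by (simp add: algebra_simps)
    then have "Z' u + 4 * ?e \<le> 0" using \<nu> by (simp add: mult_le_0_iff)
    then have "(Z' u + 4 * ?e) * exp (4 * u) \<le> 0" by (simp add: mult_le_0_iff)
    then show ?thesis by (simp add: E'_def algebra_simps)
  qed
  have lower: "E t \<le> E s" if "s \<le> t" for s
    by (rule positive_part_antimono[OF that pos dE neg])
  have upper: "E s \<le> \<bar>B\<bar> * exp (2 * s)" if "s \<le> 0" for s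
  proof -
    have "E s \<le> Z s * exp (4 * s)" using \<open>F \<ge> 0\<close> \<alpha>0 by (simp add: E_def)
    also have "\<dots> \<le> B * exp (- 2 * s) * exp (4 * s)"
      by (intro mult_right_mono growth that) auto
    also have "\<dots> = B * exp (2 * s)" by (simp add: mult.assoc flip: exp_add)
    also have "\<dots> \<le> \<bar>B\<bar> * exp (2 * s)" by (intro mult_right_mono) auto
    finally show ?thesis .
  qed
  \<comment> \<open>The two bounds cross as soon as \<open>\<bar>B\<bar> * exp (2 * s) \<le> E t / 2\<close>.\<close>
  define s where "s = min (min t 0) (ln (E t / (2 * (\<bar>B\<bar> + 1))) / 2)"
  have "exp (2 * s) \<le> E t / (2 * (\<bar>B\<bar> + 1))"
  proof -
    have q: "E t / (2 * (\<bar>B\<bar> + 1)) > 0" using pos by simp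
    have "2 * s \<le> ln (E t / (2 * (\<bar>B\<bar> + 1)))" unfolding s_def by linarith
    then show ?thesis using q by (simp add: ln_ge_iff)
  qed
  then have "(\<bar>B\<bar> + 1) * exp (2 * s) \<le> E t / 2" by (simp add: field_simps)
  moreover have "E t \<le> \<bar>B\<bar> * exp (2 * s)"
  proof -
    have "s \<le> t" "s \<le> 0" unfolding s_def by linarith+
    then show ?thesis using lower[of s] upper[of s] by linarith
  qed
  ultimately show False using pos by (simp add: distrib_right) (smt (verit) exp_gt_zero)
qed

lemma linear_ode_bounded:
  fixes Z :: "real \<Rightarrow> real"
  assumes "\<nu> > 0" and "\<alpha> \<ge> 4 * \<nu>"
    and d: "\<And>t. (Z has_real_derivative Z' t) (at t)"
    and eq: "\<And>t. \<nu> * Z' t + a t * Z t = f t"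
    and "\<And>t. a t \<ge> \<alpha>" and f: "\<And>t. \<bar>f t\<bar> \<le> F"
    and growth: "\<And>t. t \<le> 0 \<Longrightarrow> \<bar>Z t\<bar> \<le> B * exp (- 2 * t)"
  shows "\<bar>Z t\<bar> \<le> F / \<alpha>"
proof -
  have F: "f t \<le> F" "- f t \<le> F" "F \<ge> 0" for t using f[of t] by auto
  have "Z t \<le> F / \<alpha>"
    by (rule linear_ode_bounded_side[OF assms(1,2) d eq assms(5)])
      (use F order_trans[OF abs_ge_self growth] in auto)
  moreover have "- Z t \<le> F / \<alpha>"
  proof (rule linear_ode_bounded_side[OF assms(1,2) DERIV_minus[OF d] _ assms(5)])
    show "\<nu> * - Z' t + a t * - Z t = - f t" for t using eq[of t] by simp
    show "- Z t \<le> B * exp (- 2 * t)" if "t \<le> 0" for t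
      using growth[OF that] abs_ge_minus_self[of "Z t"] by linarith
  qed (use F in auto)
  ultimately show ?thesis by linarith
qed

text \<open>Only the sign of \<open>y'\<close> at the level itself is available: a Riccati solution does decrease when it is
  far below the slow curves. Hence the argument at the last time at which \<open>y \<ge> c\<close>.\<close>

lemma stays_above_level:
  fixes y :: "real \<Rightarrow> real"
  assumes d: "\<And>t. (y has_real_derivative y' t) (at t)"
    and cross: "\<And>t. y t = c \<Longrightarrow> y' t > 0"
    and "y a \<ge> c" and "a \<le> b"
  shows "y b \<ge> c"
proof (rule ccontr)
  assume "\<not> c \<le> y b"
  define Z where "Z = {x\<in>{a..b}. c \<le> y x}"
  have cont: "continuous_on A y" for A
    using d by (meson DERIV_isCont continuous_at_imp_continuous_on)
  have "closed Z" unfolding Z_def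
    by (rule continuous_on_closed_Collect_le[OF continuous_on_const cont closed_atLeastAtMost])
  moreover have "bounded Z"
    by (rule bounded_subset[OF bounded_closed_interval[of a b]]) (auto simp: Z_def)
  ultimately have "compact Z" by (simp add: compact_eq_bounded_closed)
  moreover have "a \<in> Z" using assms by (simp add: Z_def)
  ultimately obtain s where s: "s \<in> Z" "\<And>x. x \<in> Z \<Longrightarrow> x \<le> s"
    using compact_attains_sup by (metis empty_iff)
  have "a \<le> s" "s < b" "y s \<ge> c"
    using s(1) \<open>\<not> c \<le> y b\<close> by (auto simp: Z_def less_le)
  have "y s = c"
  proof (rule ccontr)
    assume "y s \<noteq> c"
    then have "\<exists>x\<ge>s. x \<le> b \<and> y x = c"
      using \<open>s < b\<close> \<open>y s \<ge> c\<close> \<open>\<not> c \<le> y b\<close> cont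
      by (intro IVT2') auto
    then obtain x where "s \<le> x" "x \<le> b" "y x = c" by blast
    then have "x \<in> Z" using \<open>a \<le> s\<close> by (simp add: Z_def)
    then have "x = s" using s(2) \<open>s \<le> x\<close> by fastforce
    then show False using \<open>y s \<noteq> c\<close> \<open>y x = c\<close> by simp
  qed
  then obtain e where e: "e > 0" "\<And>h. 0 < h \<Longrightarrow> h < e \<Longrightarrow> y s < y (s + h)"
    using DERIV_pos_inc_right[OF d cross] by metis
  define h where "h = min (e / 2) (b - s)"
  have h: "0 < h" "h < e" "s + h \<le> b" using e(1) \<open>s < b\<close> by (auto simp: h_def)
  then have "s + h \<in> Z" using e(2)[of h] \<open>y s = c\<close> \<open>a \<le> s\<close> by (simp add: Z_def)
  then show False using s(2)[of "s + h"] h(1) by simp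
qed

text \<open>With \<open>G = y - w\<close> the equation reads
  \<open>\<nu> G' = 2\<nu>\<^sup>2 - G w - G\<^sup>2 / 2 - \<nu> w'\<close>. Where \<open>G\<close> exceeds \<open>(K + 2) / \<delta> * \<nu>\<close>, the damping term
  \<open>G w\<close> absorbs the two error terms of size \<open>\<nu> s\<close>, and the remaining \<open>- G\<^sup>2 / 2\<close> would cause a
  blow-up in backward time.\<close>

lemma riccati_upper_bound:
  fixes y w :: "real \<Rightarrow> real"
  assumes "\<nu> > 0" "\<nu> \<le> s" "\<delta> > 0" "K \<ge> 0"
    and y: "\<And>t. (y has_real_derivative y' t) (at t)"
    and w: "\<And>t. (w has_real_derivative w' t) (at t)"
    and eq: "\<And>t. \<nu> * y' t = (w t)\<^sup>2 / 2 + 2 * \<nu>\<^sup>2 - (y t)\<^sup>2 / 2"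
    and low: "\<And>t. w t \<ge> \<delta> * s" and w': "\<And>t. \<bar>w' t\<bar> \<le> K * s"
  shows "y t \<le> w t + (K + 2) / \<delta> * \<nu>"
proof -
  define C where "C = (K + 2) / \<delta>"
  have C: "C > 0" "C * \<delta> = K + 2" using assms by (auto simp: C_def)
  have "y t - w t \<le> C * \<nu>"
  proof (rule no_backward_global_riccati[where G = "\<lambda>t. y t - w t" and k = "1 / (2 * \<nu>)"
        and G' = "\<lambda>t. y' t - w' t"])
    show "((\<lambda>t. y t - w t) has_real_derivative y' t - w' t) (at t)" for t
      by (intro DERIV_diff y w)
    fix t assume G: "C * \<nu> < y t - w t"
    let ?G = "y t - w t"
    have "\<nu> * (y' t - w' t) = 2 * \<nu>\<^sup>2 - ?G * w t - ?G\<^sup>2 / 2 - \<nu> * w' t"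
      using eq[of t] by (simp add: power2_eq_square field_simps)
    moreover have "(C * \<nu>) * (\<delta> * s) \<le> ?G * w t"
      using G low[of t] \<open>\<nu> > 0\<close> \<open>\<nu> \<le> s\<close> \<open>\<delta> > 0\<close> mult_pos_pos[OF C(1) \<open>\<nu> > 0\<close>]
      by (intro mult_mono) auto
    moreover have "(C * \<nu>) * (\<delta> * s) = \<nu> * s * K + 2 * (\<nu> * s)"
    proof -
      have "(C * \<nu>) * (\<delta> * s) = (C * \<delta>) * \<nu> * s" by simp
      then show ?thesis unfolding C(2) by (simp add: algebra_simps)
    qed
    moreover have "\<nu>\<^sup>2 \<le> \<nu> * s" using assms by (simp add: power2_eq_square)
    moreover have "- (\<nu> * w' t) \<le> \<nu> * s * K"
      using mult_left_mono[of "- w' t" "K * s" \<nu>] w'[of t] \<open>\<nu> > 0\<close> by (simp add: algebra_simps)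
    ultimately have "\<nu> * (y' t - w' t) \<le> - (?G\<^sup>2 / 2)" by linarith
    then show "y' t - w' t \<le> - (1 / (2 * \<nu>)) * ?G\<^sup>2"
      using \<open>\<nu> > 0\<close> by (simp add: field_simps)
  qed (use assms C in auto)
  then show ?thesis by (simp add: C_def)
qed

text \<open>The equation has two slow curves, near \<open>w\<close> and near \<open>- w\<close>, and a solution that starts at any level
  above the lower curve is attracted by the upper one. The hypothesis \<open>freq\<close> supplies starting points
  arbitrarily far in the past. From there on the solution stays above \<open>- (\<delta> * s / 2)\<close>, and as long
  as it is more than \<open>C * \<nu>\<close> below \<open>w\<close>, the distance shrinks at a rate of at least \<open>s\<close>. As the
  initial distance is bounded, the deficit is used up by any fixed time.\<close>

lemma riccati_lower_bound:
  fixes y w :: "real \<Rightarrow> real"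
  assumes "\<nu> > 0" "s > 0" "\<delta> > 0" "K \<ge> 0"
    and y: "\<And>t. (y has_real_derivative y' t) (at t)"
    and w: "\<And>t. (w has_real_derivative w' t) (at t)"
    and eq: "\<And>t. \<nu> * y' t = (w t)\<^sup>2 / 2 + 2 * \<nu>\<^sup>2 - (y t)\<^sup>2 / 2"
    and low: "\<And>t. w t \<ge> \<delta> * s" and high: "\<And>t. w t \<le> M * s" and w': "\<And>t. \<bar>w' t\<bar> \<le> K * s"
    and freq: "\<And>T. \<exists>t<T. y t > - (\<delta> * s / 2)"
  shows "y t \<ge> w t - 4 * (K + 1) / \<delta> * \<nu>"
proof (rule ccontr)
  assume neg: "\<not> ?thesis"
  define C where "C = 4 * (K + 1) / \<delta>"
  have C: "C > 0" "C * \<delta> = 4 * (K + 1)" using assms by (auto simp: C_def)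
  define E where "E u = w u - C * \<nu> - y u" for u
  have Et: "E t > 0" using neg by (simp add: E_def C_def)
  have \<delta>s: "\<delta> * s > 0" using assms by simp
  obtain a where a: "a < t - (M + \<delta>)" "y a > - (\<delta> * s / 2)" using freq by blast
  have "M * s \<ge> \<delta> * s" using low[of 0] high[of 0] by linarith
  then have "M \<ge> \<delta>" using \<open>s > 0\<close> by simp
  then have "a \<le> t" using a(1) \<open>\<delta> > 0\<close> by linarith
  have above: "y u \<ge> - (\<delta> * s / 2)" if "a \<le> u" for u
  proof (rule stays_above_level[OF y _ _ that])
    fix t assume yt: "y t = - (\<delta> * s / 2)"
    have "(\<delta> * s)\<^sup>2 \<le> (w t)\<^sup>2" using low[of t] \<delta>s by (intro power_mono) auto
    moreover have "(y t)\<^sup>2 = (\<delta> * s)\<^sup>2 / 4" by (simp add: yt power_divide)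
    moreover have "(\<delta> * s)\<^sup>2 > 0" using \<delta>s by (rule zero_less_power)
    moreover have "\<nu>\<^sup>2 > 0" using \<open>\<nu> > 0\<close> by simp
    ultimately have "\<nu> * y' t > 0" unfolding eq by linarith
    then show "y' t > 0" using \<open>\<nu> > 0\<close> by (simp add: zero_less_mult_iff)
  qed (use a in auto)
  \<comment> \<open>Monotonicity of \<open>F\<close> expresses that \<open>E\<close> decreases at rate at least \<open>s\<close>.\<close>
  define F where "F u = E u - s * (t - u)" for u
  have "F t \<le> F a"
  proof (rule positive_part_antimono[OF \<open>a \<le> t\<close>, where E' = "\<lambda>u. w' u - y' u + s"])
    show "F t > 0" using Et by (simp add: F_def)
    show "(F has_real_derivative w' u - y' u + s) (at u)" for u
      unfolding F_def E_def by (auto intro!: derivative_eq_intros w y)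
    fix u assume u: "a \<le> u" "u \<le> t" "F u > 0"
    have "s * (t - u) \<ge> 0" using u \<open>s > 0\<close> by simp
    then have Eu: "w u - y u > C * \<nu>" using u by (simp add: F_def E_def)
    have "\<nu> * (w' u - y' u) = \<nu> * w' u - 2 * \<nu>\<^sup>2 - (w u - y u) * (w u + y u) / 2"
      using eq[of u] by (simp add: power2_eq_square algebra_simps diff_divide_distrib)
    moreover have "(C * \<nu>) * (\<delta> * s / 2) \<le> (w u - y u) * (w u + y u)"
      using Eu \<delta>s low[of u] above[OF u(1)] mult_pos_pos[OF C(1) \<open>\<nu> > 0\<close>]
      by (intro mult_mono) auto
    moreover have "(C * \<nu>) * (\<delta> * s / 2) = 2 * (\<nu> * s * K) + 2 * (\<nu> * s)"
    proof -
      have "(C * \<nu>) * (\<delta> * s / 2) = (C * \<delta>) * \<nu> * s / 2" by simp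
      then show ?thesis unfolding C(2) by (simp add: algebra_simps)
    qed
    moreover have "\<nu> * w' u \<le> \<nu> * s * K"
      using mult_left_mono[of "w' u" "K * s" \<nu>] w'[of u] \<open>\<nu> > 0\<close> by (simp add: algebra_simps)
    moreover have "\<nu>\<^sup>2 \<ge> 0" by simp
    ultimately have "\<nu> * (w' u - y' u) + \<nu> * s \<le> 0" by linarith
    then have "\<nu> * (w' u - y' u + s) \<le> 0" by (simp add: distrib_left)
    then show "w' u - y' u + s \<le> 0" using \<open>\<nu> > 0\<close> by (simp add: mult_le_0_iff)
  qed
  moreover have "F a \<le> (M + \<delta>) * s - s * (t - a)"
  proof -
    have "C * \<nu> > 0" using C(1) \<open>\<nu> > 0\<close> by (rule mult_pos_pos)
    then show ?thesis
      using high[of a] a(2) \<delta>s unfolding F_def E_def distrib_right by linarith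
  qed
  moreover have "(M + \<delta>) * s < (t - a) * s" using a(1) \<open>s > 0\<close> by simp
  ultimately show False using Et by (simp add: F_def algebra_simps)
qed

lemma antiderivative_real:
  fixes f :: "real \<Rightarrow> real"
  assumes "continuous_on UNIV f"
  obtains F where "\<And>x. (F has_real_derivative f x) (at x)"
proof -
  have "\<exists>F. \<forall>x :: real. -\<infinity> < ereal x \<longrightarrow> ereal x < \<infinity> \<longrightarrow> (F has_vector_derivative f x) (at x)"
    using assms by (intro einterval_antiderivative) (auto simp: continuous_on_eq_continuous_at)
  then show ?thesis
    using that by (auto simp: has_real_derivative_iff_has_vector_derivative)
qed

text \<open>If \<open>y\<close> and \<open>y + 1 / z\<close> both solve the Riccati equation, then \<open>z\<close> solves this linear equation. Its
  solutions are \<open>exp A * (G + const)\<close>, where \<open>G\<close> is an antiderivative of \<open>exp (- A) / (2 * \<nu>)\<close>; a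
  positive one exists if and only if \<open>G\<close> is bounded below, that is, if \<open>exp (- A)\<close> is integrable at
  \<open>- \<infinity>\<close>. This holds when \<open>y\<close> is eventually below a negative constant there.\<close>

lemma positive_global_linear_solution:
  fixes y :: "real \<Rightarrow> real"
  assumes "\<nu> > 0" "\<eta> > 0" and cont: "continuous_on UNIV y"
    and neg: "\<And>t. t \<le> T \<Longrightarrow> y t \<le> - \<eta>"
  obtains z where "\<And>t. z t > 0" "\<And>t. (z has_real_derivative (y t * z t + 1 / 2) / \<nu>) (at t)"
proof -
  have "continuous_on UNIV (\<lambda>t. y t / \<nu>)"
    using cont \<open>\<nu> > 0\<close> by (auto intro!: continuous_intros)
  from antiderivative_real[OF this]
  obtain A where A: "\<And>t. (A has_real_derivative y t / \<nu>) (at t)" by blast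
  define H where "H t = exp (- A t)" for t
  have H: "(H has_real_derivative - (y t / \<nu>) * H t) (at t)" for t
    unfolding H_def by (auto intro!: derivative_eq_intros A)
  have Hpos: "H t > 0" for t by (simp add: H_def)
  have "continuous_on UNIV H"
    using H by (meson DERIV_isCont continuous_at_imp_continuous_on)
  then have "continuous_on UNIV (\<lambda>t. H t / (2 * \<nu>))"
    using \<open>\<nu> > 0\<close> by (auto intro!: continuous_intros)
  from antiderivative_real[OF this]
  obtain G where G: "\<And>t. (G has_real_derivative H t / (2 * \<nu>)) (at t)" by blast
  define g where "g = G T - H T / (2 * \<eta>)"
  have low: "G t \<ge> g" for t
  proof (cases "t \<le> T")
    case True
    \<comment> \<open>\<open>H' \<ge> (\<eta> / \<nu>) * H\<close> on this half-line, so \<open>H / (2 * \<eta>)\<close> grows at least as fast as \<open>G\<close>.\<close>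
    have "G t - H t / (2 * \<eta>) \<ge> G T - H T / (2 * \<eta>)"
    proof (rule DERIV_nonpos_imp_nonincreasing[OF True])
      fix u assume u: "t \<le> u" "u \<le> T"
      have "((\<lambda>t. G t - H t / (2 * \<eta>)) has_real_derivative
          H u / (2 * \<nu>) - (- (y u / \<nu>) * H u) / (2 * \<eta>)) (at u)"
        by (intro DERIV_diff G DERIV_cdivide H)
      moreover have "H u / (2 * \<nu>) - (- (y u / \<nu>) * H u) / (2 * \<eta>) = (H u / (2 * \<nu> * \<eta>)) * (\<eta> + y u)"
        using assms by (simp add: field_simps)
      moreover have "\<dots> \<le> 0"
        using neg[OF u(2)] Hpos[of u] assms by (intro mult_nonneg_nonpos) (auto intro!: divide_nonneg_pos less_imp_le)
      ultimately show "\<exists>y. ((\<lambda>t. G t - H t / (2 * \<eta>)) has_real_derivative y) (at u) \<and> y \<le> 0"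
        by metis
    qed
    moreover have "H t / (2 * \<eta>) > 0" using Hpos assms by simp
    ultimately show ?thesis by (simp add: g_def)
  next
    case False
    have "G T \<le> G t"
    proof (rule DERIV_nonneg_imp_nondecreasing[where f = G])
      show "\<exists>y. (G has_real_derivative y) (at u) \<and> 0 \<le> y" for u
        using G[of u] Hpos[of u] \<open>\<nu> > 0\<close> by (intro exI[of _ "H u / (2 * \<nu>)"]) auto
    qed (use False in auto)
    moreover have "H T / (2 * \<eta>) > 0" using Hpos assms by simp
    ultimately show ?thesis by (simp add: g_def)
  qed
  define z where "z t = exp (A t) * (G t - g + 1)" for t
  have "z t > 0" for t using low[of t] by (simp add: z_def)
  moreover have "(z has_real_derivative (y t * z t + 1 / 2) / \<nu>) (at t)" for t
  proof -
    have "(z has_real_derivative (exp (A t) * (y t / \<nu>)) * (G t - g + 1) + exp (A t) * (H t / (2 * \<nu>))) (at t)"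
      unfolding z_def by (auto intro!: derivative_eq_intros A G)
    moreover have "exp (A t) * H t = 1" by (simp add: H_def flip: exp_add)
    ultimately show ?thesis
      using \<open>\<nu> > 0\<close> by (simp add: z_def field_simps)
  qed
  ultimately show ?thesis using that by blast
qed

section \<open>The change of variable x = tanh t\<close>

lemma tanh_artanh_real:
  fixes x :: real
  assumes "-1 < x" "x < 1"
  shows "tanh (artanh x) = x"
proof -
  have "exp (- 2 * artanh x) = (1 - x) / (1 + x)"
    using assms by (simp add: artanh_def exp_minus)
  then have "tanh (artanh x) = (1 - (1 - x) / (1 + x)) / (1 + (1 - x) / (1 + x))"
    by (simp only: tanh_real_altdef)
  also have "\<dots> = (1 + x - (1 - x)) / (1 + x + (1 - x))"
    using assms by (simp add: diff_divide_eq_iff add_divide_eq_iff)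
  finally show ?thesis by simp
qed

lemma has_deriv_comp_tanh:
  fixes f :: "real \<Rightarrow> real"
  assumes "\<And>x. x \<in> {-1<..<1} \<Longrightarrow> (f has_real_derivative f' x) (at x)"
  shows "((\<lambda>t. f (tanh t)) has_real_derivative f' (tanh t) * (1 - (tanh t)\<^sup>2)) (at t)"
  by (rule DERIV_chain2[where f = f and g = tanh])
    (auto intro!: derivative_eq_intros assms tanh_real_bounds)

lemma one_minus_tanh_squared_ge:
  fixes t :: real
  assumes "t \<le> 0"
  shows "exp (2 * t) \<le> 1 - (tanh t)\<^sup>2"
proof -
  define q where "q = exp (- 2 * t)"
  have q: "q \<ge> 1" using assms by (simp add: q_def)
  have "exp (2 * t) = inverse q" by (simp add: q_def exp_minus)
  have "(1 + q)\<^sup>2 \<le> (2 * q)\<^sup>2" using q by (intro power_mono) auto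
  then have "(1 + q)\<^sup>2 \<le> 4 * q * q" by (simp add: power2_eq_square)
  then have "inverse q \<le> 4 * q / (1 + q)\<^sup>2"
    using q by (simp add: field_simps)
  also have "\<dots> = 1 - ((1 - q) / (1 + q))\<^sup>2"
  proof -
    have "4 * q = (1 + q)\<^sup>2 - (1 - q)\<^sup>2" by (simp add: power2_eq_square algebra_simps)
    moreover have "(1 + q)\<^sup>2 \<noteq> 0" using q by simp
    ultimately show ?thesis unfolding power_divide by (simp add: diff_divide_eq_iff)
  qed
  finally show ?thesis
    using \<open>exp (2 * t) = inverse q\<close> by (simp add: tanh_real_altdef q_def)
qed

lemma one_minus_square_pos: "x \<in> {-1<..<1::real} \<Longrightarrow> 1 - x\<^sup>2 > 0"
  using abs_square_less_1[of x] by auto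

text \<open>In the variable \<open>t = artanh x\<close> the degenerate operator \<open>(1 - x\<^sup>2) d/dx\<close> is \<open>d/dt\<close>. Near
  \<open>x = -1\<close> the factor \<open>1 - x\<^sup>2\<close> behaves like \<open>exp (2 * t)\<close>, which turns the crude bound \<open>growth\<close> into
  the subcritical growth required in the non-degenerate case.\<close>

lemma degenerate_linear_ode_bounded:
  fixes Z :: "real \<Rightarrow> real"
  assumes "\<nu> > 0" and "\<alpha> \<ge> 4 * \<nu>"
    and d: "\<And>x. x \<in> {-1<..<1} \<Longrightarrow> (Z has_real_derivative Z' x) (at x)"
    and eq: "\<And>x. x \<in> {-1<..<1} \<Longrightarrow> \<nu> * (1 - x\<^sup>2) * Z' x + a x * Z x = f x"
    and a: "\<And>x. x \<in> {-1<..<1} \<Longrightarrow> a x \<ge> \<alpha>"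
    and f: "\<And>x. x \<in> {-1<..<1} \<Longrightarrow> \<bar>f x\<bar> \<le> F"
    and growth: "\<And>x. x \<in> {-1<..<1} \<Longrightarrow> (1 - x\<^sup>2) * \<bar>Z x\<bar> \<le> B"
    and x: "x \<in> {-1<..<1}"
  shows "\<bar>Z x\<bar> \<le> F / \<alpha>"
proof -
  have "\<bar>Z (tanh (artanh x))\<bar> \<le> F / \<alpha>"
  proof (rule linear_ode_bounded[OF assms(1,2) has_deriv_comp_tanh[OF d]])
    show "\<nu> * (Z' (tanh t) * (1 - (tanh t)\<^sup>2)) + a (tanh t) * Z (tanh t) = f (tanh t)" for t :: real
      using eq[OF tanh_real_bounds[of t]] by (simp add: mult_ac)
    show "\<bar>Z (tanh t)\<bar> \<le> B * exp (- 2 * t)" if "t \<le> 0" for t :: real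
    proof -
      have "exp (2 * t) * \<bar>Z (tanh t)\<bar> \<le> (1 - (tanh t)\<^sup>2) * \<bar>Z (tanh t)\<bar>"
        using one_minus_tanh_squared_ge[OF that] by (intro mult_right_mono) auto
      also have "\<dots> \<le> B" by (rule growth[OF tanh_real_bounds])
      finally show ?thesis by (simp add: exp_minus field_simps)
    qed
  qed (use a f tanh_real_bounds in auto)
  then show ?thesis using tanh_artanh_real x by simp
qed

section \<open>Derivatives of the distance to the slow curve\<close>

text \<open>\<open>W\<close> is the slow curve and \<open>Y\<close> a solution that is already known to be uniformly close to it. The
  number \<open>s p\<close> is the size of \<open>W p\<close>; keeping it as a weight replaces a rescaling to \<open>s = 1\<close>. The
  hypothesis \<open>small\<close> ensures that the equations for the first \<open>N\<close> derivatives of the difference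
  remain damped.\<close>

locale riccati_family =
  fixes \<P> :: "'p set" and \<nu> s :: "'p \<Rightarrow> real" and W Y :: "'p \<Rightarrow> real \<Rightarrow> real"
    and \<delta> C :: real and N :: nat
  assumes \<nu>: "\<And>p. p \<in> \<P> \<Longrightarrow> 0 < \<nu> p" and \<nu>_le_s: "\<And>p. p \<in> \<P> \<Longrightarrow> \<nu> p \<le> s p"
    and \<delta>: "\<delta> > 0"
    and W_O: "\<And>n. unif_O {-1<..<1} \<P> n s W"
    and W_low: "\<And>p x. p \<in> \<P> \<Longrightarrow> x \<in> {-1<..<1} \<Longrightarrow> W p x \<ge> \<delta> * s p"
    and Y_deriv: "\<And>p x. p \<in> \<P> \<Longrightarrow> x \<in> {-1<..<1} \<Longrightarrow> (Y p has_real_derivative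
        ((W p x)\<^sup>2 / 2 + 2 * (\<nu> p)\<^sup>2 - (Y p x)\<^sup>2 / 2) / (\<nu> p * (1 - x\<^sup>2))) (at x)"
    and close: "\<And>p x. p \<in> \<P> \<Longrightarrow> x \<in> {-1<..<1} \<Longrightarrow> \<bar>Y p x - W p x\<bar> \<le> C * \<nu> p"
    and small: "\<And>p. p \<in> \<P> \<Longrightarrow> (2 * C + 4 * N + 8) * \<nu> p \<le> \<delta> * s p"
begin

abbreviation S :: "real set" where "S \<equiv> {-1<..<1}"

lemma open_S: "open S" by simp

lemma s_pos: "p \<in> \<P> \<Longrightarrow> s p > 0"
  using \<nu> \<nu>_le_s by fastforce

lemma W_smooth: "p \<in> \<P> \<Longrightarrow> smooth_on S (W p)"
  using unif_O_smooth[OF open_S W_O] .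

lemma Y_smooth:
  assumes p: "p \<in> \<P>" shows "smooth_on S (Y p)"
proof (rule smooth_on_induct[OF open_S])
  show "(Y p has_real_derivative (1 / 2 * (W p x * W p x) + 2 * (\<nu> p)\<^sup>2 - 1 / 2 * (Y p x * Y p x))
      * inverse (\<nu> p * (1 - x * x))) (at x)" if "x \<in> S" for x
    by (rule DERIV_cong[OF Y_deriv[OF p that]]) (simp only: divide_inverse power2_eq_square, simp)
  fix n assume n: "ndiff n S (Y p)"
  have pol: "smooth_on S (\<lambda>x. \<nu> p * (1 - x * x))"
    by (intro smooth_on_mult smooth_on_diff smooth_on_const smooth_on_ident open_S)
  have "\<nu> p * (1 - x * x) \<noteq> 0" if "x \<in> S" for x
    using one_minus_square_pos[OF that] \<nu>[OF p] by (simp add: power2_eq_square)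
  then have i: "ndiff n S (\<lambda>x. inverse (\<nu> p * (1 - x * x)))"
    by (rule smooth_on_imp_ndiff[OF smooth_on_inverse[OF open_S pol]])
  have w: "ndiff n S (\<lambda>x. 1 / 2 * (W p x * W p x) + 2 * (\<nu> p)\<^sup>2)"
    by (rule smooth_on_imp_ndiff)
      (intro smooth_on_add smooth_on_mult smooth_on_const W_smooth p open_S)
  have y: "ndiff n S (\<lambda>x. (- (1 / 2)) * (Y p x * Y p x))"
    by (intro ndiff_mult[OF open_S] ndiff_const[OF open_S] n)
  show "ndiff n S (\<lambda>x. (1 / 2 * (W p x * W p x) + 2 * (\<nu> p)\<^sup>2 - 1 / 2 * (Y p x * Y p x))
      * inverse (\<nu> p * (1 - x * x)))"
    using ndiff_mult[OF open_S ndiff_add[OF open_S w y] i] by simp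
qed

definition D :: "'p \<Rightarrow> real \<Rightarrow> real" where "D p x = Y p x - W p x"

definition h :: "'p \<Rightarrow> real \<Rightarrow> real" where "h p x = 2 * \<nu> p - (1 - x * x) * deriv (W p) x"

text \<open>The right-hand side of the linear equation for the derivative of order \<open>i + 1\<close> of \<open>D p\<close>, obtained by
  differentiating the equation for \<open>D p\<close> that many times. It contains derivatives of \<open>D p\<close> up to
  order \<open>i\<close> only.\<close>

primrec T :: "nat \<Rightarrow> 'p \<Rightarrow> real \<Rightarrow> real" where
  "T 0 p = (\<lambda>x. \<nu> p * deriv (h p) x - deriv (W p) x * D p x)"
| "T (Suc i) p = (\<lambda>x. deriv (T i p) x -
     (deriv (D p) x + deriv (W p) x - 2 * real (Suc i) * \<nu> p) * (deriv ^^ Suc i) (D p) x)"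

lemma D_smooth: "p \<in> \<P> \<Longrightarrow> smooth_on S (D p)"
  unfolding D_def[abs_def] by (intro smooth_on_diff Y_smooth W_smooth open_S)

lemma weight_\<nu>_s: "unif_O S \<P> n \<nu> f \<Longrightarrow> unif_O S \<P> n s f"
  by (erule unif_O_weight[OF open_S, where K = 1]) (use \<nu> \<nu>_le_s in force)

lemma h_O: "unif_O S \<P> n s h"
proof -
  have "unif_O S \<P> n s (\<lambda>p x. 2 * \<nu> p)"
    by (rule unif_O_const[OF open_S, where K = 2]) (use \<nu> \<nu>_le_s in force)
  moreover have "unif_O S \<P> n (\<lambda>p. 1) (\<lambda>p x. 1 - x * x)"
    using unif_O_diff[OF open_S unif_O_const[OF open_S, where a = "\<lambda>p. 1" and K = 1]
        unif_O_mult[OF open_S unif_O_ident unif_O_ident]] by simp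
  then have "unif_O S \<P> n (\<lambda>p. 1 * s p) (\<lambda>p x. (1 - x * x) * deriv (W p) x)"
    by (intro unif_O_mult[OF open_S] unif_O_deriv[OF open_S] W_O)
  ultimately show ?thesis
    unfolding h_def[abs_def] by (intro unif_O_diff[OF open_S]) simp_all
qed

text \<open>A bound on \<open>T i\<close> in \<open>C\<^sup>k\<close> uses derivatives of \<open>D\<close> up to order \<open>k + i\<close>. The statement is made for all
  \<open>k\<close> because the recursion differentiates \<open>T i\<close>.\<close>

lemma T_O:
  "unif_O S \<P> (k + i) \<nu> D \<Longrightarrow> unif_O S \<P> k (\<lambda>p. \<nu> p * s p) (T i)"
proof (induction i arbitrary: k)
  case 0
  have "unif_O S \<P> k (\<lambda>p. \<nu> p * s p) (\<lambda>p x. \<nu> p * deriv (h p) x)"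
    by (intro unif_O_mult[OF open_S] unif_O_deriv[OF open_S] h_O
        unif_O_const[OF open_S, where K = 1]) auto
  moreover have "unif_O S \<P> k (\<lambda>p. s p * \<nu> p) (\<lambda>p x. deriv (W p) x * D p x)"
    using 0 by (intro unif_O_mult[OF open_S] unif_O_deriv[OF open_S] W_O) simp
  ultimately show ?case
    by (simp add: mult.commute[of "s _"] unif_O_diff[OF open_S])
next
  case (Suc i)
  have "unif_O S \<P> k (\<lambda>p. \<nu> p * s p) (\<lambda>p. deriv (T i p))"
    by (rule unif_O_deriv[OF open_S]) (use Suc in simp)
  moreover have "unif_O S \<P> k (\<lambda>p. s p * \<nu> p) (\<lambda>p x.
      (deriv (D p) x + deriv (W p) x - 2 * real (Suc i) * \<nu> p) * (deriv ^^ Suc i) (D p) x)"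
  proof (intro unif_O_mult[OF open_S] unif_O_diff[OF open_S] unif_O_add[OF open_S])
    show "unif_O S \<P> k s (\<lambda>p. deriv (D p))"
      by (intro weight_\<nu>_s unif_O_deriv[OF open_S] unif_O_lower[OF open_S Suc.prems]) simp
    show "unif_O S \<P> k s (\<lambda>p. deriv (W p))" by (intro unif_O_deriv[OF open_S] W_O)
    show "unif_O S \<P> k s (\<lambda>p x. 2 * real (Suc i) * \<nu> p)"
      by (rule unif_O_const[OF open_S, where K = "2 * real (Suc i)"])
        (use \<nu> \<nu>_le_s in \<open>force simp: abs_mult intro!: mult_left_mono\<close>)
    show "unif_O S \<P> k \<nu> (\<lambda>p. (deriv ^^ Suc i) (D p))"
      by (rule unif_O_funpow[OF open_S Suc.prems])
  qed
  ultimately show ?case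
    by (simp add: mult.commute[of "s _"] unif_O_diff[OF open_S])
qed

lemma T_smooth: assumes p: "p \<in> \<P>" shows "smooth_on S (T i p)"
proof (induction i)
  case 0
  show ?case unfolding T.simps
    by (intro smooth_on_diff smooth_on_mult smooth_on_const smooth_on_deriv open_S D_smooth p
        W_smooth unif_O_smooth[OF open_S h_O])
next
  case (Suc i)
  show ?case unfolding T.simps
    by (intro smooth_on_diff smooth_on_mult smooth_on_add smooth_on_const smooth_on_deriv open_S
        D_smooth p W_smooth smooth_on_funpow Suc)
qed

lemma D_eq:
  assumes p: "p \<in> \<P>" and x: "x \<in> S"
  shows "\<nu> p * (1 - x * x) * deriv (D p) x + (D p x)\<^sup>2 / 2 + W p x * D p x = \<nu> p * h p x"
proof -
  have "(D p has_real_derivative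
      ((W p x)\<^sup>2 / 2 + 2 * (\<nu> p)\<^sup>2 - (Y p x)\<^sup>2 / 2) / (\<nu> p * (1 - x\<^sup>2)) - deriv (W p) x) (at x)"
    unfolding D_def[abs_def]
    by (intro DERIV_diff Y_deriv p x smooth_on_has_deriv[OF W_smooth])
  then have "deriv (D p) x =
      ((W p x)\<^sup>2 / 2 + 2 * (\<nu> p)\<^sup>2 - (Y p x)\<^sup>2 / 2) / (\<nu> p * (1 - x\<^sup>2)) - deriv (W p) x"
    by (rule DERIV_imp_deriv)
  moreover have "\<nu> p * (1 - x\<^sup>2) \<noteq> 0" using one_minus_square_pos[OF x] \<nu>[OF p] by simp
  moreover have "k * a = n - k * b" if "a = n / k - b" "k \<noteq> 0" for a b n k :: real
    using that by (simp add: right_diff_distrib)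
  ultimately have "\<nu> p * (1 - x\<^sup>2) * deriv (D p) x =
      ((W p x)\<^sup>2 / 2 + 2 * (\<nu> p)\<^sup>2 - (Y p x)\<^sup>2 / 2) - \<nu> p * (1 - x\<^sup>2) * deriv (W p) x"
    by blast
  then show ?thesis by (simp add: D_def h_def power2_eq_square field_simps)
qed

text \<open>Each differentiation of \<open>1 - x * x\<close> contributes \<open>- 2 * \<nu> p * x\<close> to the zeroth-order
  coefficient. This is small compared with \<open>W p\<close>, so the coefficient stays positive for any bounded
  number of differentiations.\<close>

lemma deriv_D_eq:
  assumes p: "p \<in> \<P>"
  shows "x \<in> S \<Longrightarrow> \<nu> p * (1 - x * x) * (deriv ^^ Suc (Suc i)) (D p) x
    + (D p x + W p x - 2 * real (Suc i) * \<nu> p * x) * (deriv ^^ Suc i) (D p) x = T i p x"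
proof (induction i arbitrary: x)
  have d: "((deriv ^^ j) (D p) has_real_derivative (deriv ^^ Suc j) (D p) x) (at x)" if "x \<in> S" for x j
    using smooth_on_has_deriv[OF smooth_on_funpow[OF D_smooth[OF p]] that] by simp
  have d0: "(D p has_real_derivative deriv (D p) x) (at x)" if "x \<in> S" for x
    using d[OF that, of 0] by simp
  have w: "(W p has_real_derivative deriv (W p) x) (at x)" if "x \<in> S" for x
    using smooth_on_has_deriv[OF W_smooth[OF p] that] .
  {
    case 0
    have "(h p has_real_derivative deriv (h p) x) (at x)"
      using smooth_on_has_deriv[OF unif_O_smooth[OF open_S h_O p] 0] .
    then have r: "((\<lambda>x. \<nu> p * h p x) has_real_derivative \<nu> p * deriv (h p) x) (at x)"
      by (rule DERIV_cmult)
    have l: "((\<lambda>x. \<nu> p * (1 - x * x) * deriv (D p) x + (D p x)\<^sup>2 / 2 + W p x * D p x)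
      has_real_derivative (\<nu> p * (- 2 * x) * deriv (D p) x + \<nu> p * (1 - x * x) * deriv (deriv (D p)) x)
        + D p x * deriv (D p) x + (deriv (W p) x * D p x + W p x * deriv (D p) x)) (at x)"
      using d[OF 0, of 1] d0[OF 0] w[OF 0]
      by (auto intro!: derivative_eq_intros simp: algebra_simps)
    show ?case
      using DERIV_unique_on_open[OF open_S D_eq[OF p] 0 l r] by (simp add: algebra_simps)
  next
    case (Suc i)
    let ?a = "\<lambda>x. (deriv ^^ Suc i) (D p) x"
    let ?b = "\<lambda>x. (deriv ^^ Suc (Suc i)) (D p) x"
    let ?c = "\<lambda>x. (deriv ^^ Suc (Suc (Suc i))) (D p) x"
    have da: "(?a has_real_derivative ?b x) (at x)" and db: "(?b has_real_derivative ?c x) (at x)"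
      using d[OF Suc.prems] by blast+
    have r: "(T i p has_real_derivative deriv (T i p) x) (at x)"
      using smooth_on_has_deriv[OF T_smooth[OF p] Suc.prems] .
    have l: "((\<lambda>x. \<nu> p * (1 - x * x) * ?b x + (D p x + W p x - 2 * real (Suc i) * \<nu> p * x) * ?a x)
      has_real_derivative (\<nu> p * (- 2 * x) * ?b x + \<nu> p * (1 - x * x) * ?c x)
        + ((deriv (D p) x + deriv (W p) x - 2 * real (Suc i) * \<nu> p) * ?a x
          + (D p x + W p x - 2 * real (Suc i) * \<nu> p * x) * ?b x)) (at x)"
      by (rule derivative_eq_intros da db d0[OF Suc.prems] w[OF Suc.prems] refl)+
        (simp add: algebra_simps)
    have "(\<nu> p * (- 2 * x) * ?b x + \<nu> p * (1 - x * x) * ?c x)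
        + ((deriv (D p) x + deriv (W p) x - 2 * real (Suc i) * \<nu> p) * ?a x
          + (D p x + W p x - 2 * real (Suc i) * \<nu> p * x) * ?b x) = deriv (T i p) x"
      by (rule DERIV_unique_on_open[OF open_S Suc.IH Suc.prems l r])
    then show ?case unfolding T.simps of_nat_Suc by (simp only: algebra_simps)
  }
qed

text \<open>Induction on the order. The derivative of order \<open>n + 1\<close> solves a damped linear equation with
  forcing \<open>T n = O(\<nu> * s)\<close> and damping at least \<open>\<delta> * s / 2\<close>, whence the bound \<open>O(\<nu>)\<close>. To exclude the
  solutions of the homogeneous equation that are singular at \<open>x = -1\<close>, it suffices to know that
  \<open>1 - x\<^sup>2\<close> times the derivative is bounded, with any constant depending on \<open>p\<close>; this is read off from
  the equation of one order lower.\<close>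

lemma D_O: "n \<le> N \<Longrightarrow> unif_O S \<P> n \<nu> D"
proof (induction n)
  case 0
  show ?case
  proof (rule unif_O_I[OF open_S D_smooth, where B = C])
    show "\<bar>(deriv ^^ j) (D p) x\<bar> \<le> C * \<bar>\<nu> p\<bar>" if "p \<in> \<P>" "j \<le> 0" "x \<in> S" for p j x
      using close[OF that(1,3)] \<nu>[OF that(1)] that(2) by (simp add: D_def)
  qed
next
  case (Suc n)
  then have O: "unif_O S \<P> n \<nu> D" by simp
  obtain B where B: "B \<ge> 0"
    "\<And>p j x. p \<in> \<P> \<Longrightarrow> j \<le> n \<Longrightarrow> x \<in> S \<Longrightarrow> \<bar>(deriv ^^ j) (D p) x\<bar> \<le> B * \<bar>\<nu> p\<bar>"
    using unif_O_boundE[OF open_S O] by metis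
  obtain F where F: "F \<ge> 0"
    "\<And>p j x. p \<in> \<P> \<Longrightarrow> j \<le> 0 \<Longrightarrow> x \<in> S \<Longrightarrow> \<bar>(deriv ^^ j) (T n p) x\<bar> \<le> F * \<bar>\<nu> p * s p\<bar>"
    using unif_O_boundE[OF open_S T_O[of 0 n]] O by auto
  have main: "\<bar>(deriv ^^ Suc n) (D p) x\<bar> \<le> (2 * F / \<delta>) * \<bar>\<nu> p\<bar>" if p: "p \<in> \<P>" and x: "x \<in> S" for p x
  proof -
    have C: "C \<ge> 0" using close[OF p x] \<nu>[OF p] by (smt (verit) mult_neg_pos)
    have Cn: "2 * (C * \<nu> p) + 4 * (N * \<nu> p) + 8 * \<nu> p \<le> \<delta> * s p"
      using small[OF p] by (simp add: algebra_simps)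
    have CN0: "C * \<nu> p \<ge> 0" "N * \<nu> p \<ge> 0" using C \<nu>[OF p] by simp_all
    have a: "D p x + W p x - 2 * real j * \<nu> p * x \<ge> \<delta> * s p / 2" if "x \<in> S" "j \<le> N" for x j
    proof -
      have "D p x \<ge> - (C * \<nu> p)" using close[OF p that(1)] by (simp add: D_def)
      moreover have "real j * \<nu> p * x \<le> real j * \<nu> p"
        using that \<nu>[OF p] by (intro mult_left_le) auto
      moreover have "real j * \<nu> p \<le> N * \<nu> p"
        using that \<nu>[OF p] by (intro mult_right_mono) auto
      ultimately show ?thesis using W_low[OF p that(1)] Cn \<nu>[OF p] by linarith
    qed
    \<comment> \<open>The constants from here to \<open>bound\<close> depend on \<open>p\<close>; they only serve to verify the growth condition.\<close>
    obtain A where A: "\<And>j x. j \<le> 0 \<Longrightarrow> x \<in> S \<Longrightarrow> \<bar>(deriv ^^ j) (W p) x\<bar> \<le> A"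
      using unif_O_boundE[OF open_S W_O[of 0]] p by metis
    obtain G where G: "\<And>j x. j \<le> 0 \<Longrightarrow> x \<in> S \<Longrightarrow> \<bar>(deriv ^^ j) (h p) x\<bar> \<le> G"
      using unif_O_boundE[OF open_S h_O[of 0]] p by metis
    obtain E where E: "\<And>j x. j \<le> 0 \<Longrightarrow> x \<in> S \<Longrightarrow> \<bar>(deriv ^^ j) (T (n - 1) p) x\<bar> \<le> E"
      using unif_O_boundE[OF open_S T_O[of 0 "n - 1"]] unif_O_lower[OF open_S O] p
      by (metis add_0 diff_le_self)
    let ?b = "B * \<nu> p"
    have D: "\<bar>(deriv ^^ j) (D p) x\<bar> \<le> ?b" if "j \<le> n" "x \<in> S" for j x
      using B(2)[OF p that] \<nu>[OF p] by simp
    have b0: "?b \<ge> 0" using B(1) \<nu>[OF p] by simp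
    have bound: "\<nu> p * ((1 - x\<^sup>2) * \<bar>(deriv ^^ Suc n) (D p) x\<bar>) \<le>
        \<bar>\<nu> p * G\<bar> + \<bar>E\<bar> + (?b + \<bar>A\<bar> + 2 * real n * \<nu> p) * ?b" if x: "x \<in> S" for x
    proof -
      have Ax: "\<bar>W p x\<bar> \<le> \<bar>A\<bar>" using A[of 0 x] x by simp
      have Dx: "\<bar>D p x\<bar> \<le> ?b" using D[of 0 x] x by simp
      have "\<bar>\<nu> p * (1 - x\<^sup>2) * (deriv ^^ Suc n) (D p) x\<bar> \<le>
        \<bar>\<nu> p * G\<bar> + \<bar>E\<bar> + (?b + \<bar>A\<bar> + 2 * real n * \<nu> p) * ?b"
      proof (cases n)
        case 0
        have "\<nu> p * (1 - x\<^sup>2) * deriv (D p) x = \<nu> p * h p x - (D p x / 2 + W p x) * D p x"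
          using D_eq[OF p x] by (simp add: power2_eq_square algebra_simps)
        moreover have "\<bar>\<nu> p * h p x\<bar> \<le> \<bar>\<nu> p * G\<bar>"
          using G[of 0 x] x \<nu>[OF p] by (simp add: abs_mult)
        moreover have "\<bar>(D p x / 2 + W p x) * D p x\<bar> \<le> (?b + \<bar>A\<bar>) * ?b"
          unfolding abs_mult using Dx Ax by (intro mult_mono) auto
        ultimately show ?thesis using 0 by simp
      next
        case (Suc k)
        have "\<nu> p * (1 - x\<^sup>2) * (deriv ^^ Suc n) (D p) x =
            T k p x - (D p x + W p x - 2 * real n * \<nu> p * x) * (deriv ^^ n) (D p) x"
          using deriv_D_eq[OF p x, of k] unfolding Suc by (simp add: power2_eq_square)
        moreover have "\<bar>T k p x\<bar> \<le> \<bar>E\<bar>" using E[of 0 x] x Suc by simp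
        moreover have "\<bar>(D p x + W p x - 2 * real n * \<nu> p * x) * (deriv ^^ n) (D p) x\<bar>
            \<le> (?b + \<bar>A\<bar> + 2 * real n * \<nu> p) * ?b"
          unfolding abs_mult
        proof (rule mult_mono)
          have "\<bar>2 * real n * \<nu> p * x\<bar> = 2 * real n * \<nu> p * \<bar>x\<bar>"
            using \<nu>[OF p] by (simp add: abs_mult)
          also have "\<dots> \<le> 2 * real n * \<nu> p"
            using x \<nu>[OF p] by (intro mult_left_le) auto
          finally have "\<bar>2 * real n * \<nu> p * x\<bar> \<le> 2 * real n * \<nu> p" .
          then show "\<bar>D p x + W p x - 2 * real n * \<nu> p * x\<bar> \<le> ?b + \<bar>A\<bar> + 2 * real n * \<nu> p"
            using Dx Ax by linarith
        qed (use D[OF _ x] b0 \<nu>[OF p] in auto)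
        ultimately show ?thesis by linarith
      qed
      moreover have "\<bar>\<nu> p * (1 - x\<^sup>2) * y\<bar> = \<nu> p * ((1 - x\<^sup>2) * \<bar>y\<bar>)" for y
        unfolding abs_mult abs_of_pos[OF \<nu>[OF p]] abs_of_pos[OF one_minus_square_pos[OF x]]
        by (simp only: mult.assoc)
      ultimately show ?thesis by simp
    qed
    have "\<bar>(deriv ^^ Suc n) (D p) x\<bar> \<le> (F * (\<nu> p * s p)) / (\<delta> * s p / 2)"
    proof (rule degenerate_linear_ode_bounded[where Z = "(deriv ^^ Suc n) (D p)", OF \<nu>[OF p]])
      show "4 * \<nu> p \<le> \<delta> * s p / 2" using Cn CN0 by linarith
      show "((deriv ^^ Suc n) (D p) has_real_derivative (deriv ^^ Suc (Suc n)) (D p) x) (at x)"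
        if "x \<in> S" for x
        using smooth_on_has_deriv[OF smooth_on_funpow[OF D_smooth[OF p], of "Suc n"] that] by simp
      show "\<nu> p * (1 - x\<^sup>2) * (deriv ^^ Suc (Suc n)) (D p) x
          + (D p x + W p x - 2 * real (Suc n) * \<nu> p * x) * (deriv ^^ Suc n) (D p) x = T n p x"
        if "x \<in> S" for x
        using deriv_D_eq[OF p that] by (simp add: power2_eq_square)
      show "D p x + W p x - 2 * real (Suc n) * \<nu> p * x \<ge> \<delta> * s p / 2" if "x \<in> S" for x
        using a[OF that, of "Suc n"] Suc.prems by simp
      show "\<bar>T n p x\<bar> \<le> F * (\<nu> p * s p)" if "x \<in> S" for x
        using F(2)[OF p _ that, of 0] \<nu>[OF p] s_pos[OF p] by simp
      show "x \<in> S" by (fact x)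
      show "(1 - x\<^sup>2) * \<bar>(deriv ^^ Suc n) (D p) x\<bar> \<le>
          (\<bar>\<nu> p * G\<bar> + \<bar>E\<bar> + (?b + \<bar>A\<bar> + 2 * real n * \<nu> p) * ?b) / \<nu> p" if "x \<in> S" for x
        using bound[OF that] \<nu>[OF p] by (simp add: pos_le_divide_eq mult.commute)
    qed
    also have "\<dots> = (2 * F / \<delta>) * \<bar>\<nu> p\<bar>"
      using s_pos[OF p] \<nu>[OF p] \<delta> by (simp add: field_simps)
    finally show ?thesis .
  qed
  show ?case
  proof (rule unif_O_I[OF open_S D_smooth, where B = "max B (2 * F / \<delta>)"])
    fix p j x assume p: "p \<in> \<P>" "j \<le> Suc n" "x \<in> S"
    have "B * \<bar>\<nu> p\<bar> \<le> max B (2 * F / \<delta>) * \<bar>\<nu> p\<bar>" "2 * F / \<delta> * \<bar>\<nu> p\<bar> \<le> max B (2 * F / \<delta>) * \<bar>\<nu> p\<bar>"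
      by (intro mult_right_mono; simp)+
    moreover have "\<bar>(deriv ^^ j) (D p) x\<bar> \<le> B * \<bar>\<nu> p\<bar> \<or> \<bar>(deriv ^^ j) (D p) x\<bar> \<le> 2 * F / \<delta> * \<bar>\<nu> p\<bar>"
      using B(2)[OF p(1) _ p(3)] main[OF p(1,3)] p(2) le_Suc_eq by metis
    ultimately show "\<bar>(deriv ^^ j) (D p) x\<bar> \<le> max B (2 * F / \<delta>) * \<bar>\<nu> p\<bar>" by linarith
  qed
qed

end

section \<open>Solutions of the Riccati equation and maximality\<close>

lemma is_solution_iff:
  assumes "\<nu> > 0"
  shows "is_solution \<nu> c U \<longleftrightarrow> (\<forall>x\<in>{-1<..<1}. (U has_real_derivative
    (P c x - 2 * \<nu> * x * U x - (U x)\<^sup>2 / 2) / (\<nu> * (1 - x\<^sup>2))) (at x))"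
proof
  assume sol: "is_solution \<nu> c U"
  show "\<forall>x\<in>{-1<..<1}. (U has_real_derivative
    (P c x - 2 * \<nu> * x * U x - (U x)\<^sup>2 / 2) / (\<nu> * (1 - x\<^sup>2))) (at x)"
  proof
    fix x :: real assume x: "x \<in> {-1<..<1}"
    have "U differentiable (at x)"
      using sol x by (auto simp: is_solution_def C1_differentiable_on_eq)
    then have "(U has_real_derivative deriv U x) (at x)"
      using DERIV_deriv_iff_real_differentiable by blast
    moreover have "\<nu> * (1 - x\<^sup>2) * deriv U x = P c x - 2 * \<nu> * x * U x - (U x)\<^sup>2 / 2"
      using sol x unfolding is_solution_def by force
    then have "deriv U x = (P c x - 2 * \<nu> * x * U x - (U x)\<^sup>2 / 2) / (\<nu> * (1 - x\<^sup>2))"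
      using one_minus_square_pos[OF x] assms
      by (simp add: eq_divide_eq mult.commute)
    ultimately show "(U has_real_derivative
      (P c x - 2 * \<nu> * x * U x - (U x)\<^sup>2 / 2) / (\<nu> * (1 - x\<^sup>2))) (at x)" by simp
  qed
next
  assume d: "\<forall>x\<in>{-1<..<1}. (U has_real_derivative
    (P c x - 2 * \<nu> * x * U x - (U x)\<^sup>2 / 2) / (\<nu> * (1 - x\<^sup>2))) (at x)"
  have "continuous_on {-1<..<1} U"
    using d by (meson DERIV_isCont continuous_at_imp_continuous_on)
  moreover have "\<nu> * (1 - x\<^sup>2) \<noteq> 0" if "x \<in> {-1<..<1}" for x
    using one_minus_square_pos[OF that] assms by simp
  ultimately have "continuous_on {-1<..<1}
      (\<lambda>x. (P c x - 2 * \<nu> * x * U x - (U x)\<^sup>2 / 2) / (\<nu> * (1 - x\<^sup>2)))"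
    unfolding P_def by (intro continuous_intros) auto
  then have "U C1_differentiable_on {-1<..<1}"
    using d unfolding C1_differentiable_on_def
    by (auto simp: has_real_derivative_iff_has_vector_derivative)
  moreover have "\<nu> * (1 - x\<^sup>2) * deriv U x + 2 * \<nu> * x * U x + 1 / 2 * (U x)\<^sup>2 = P c x"
    if x: "x \<in> {-1<..<1}" for x
    using DERIV_imp_deriv[OF d[rule_format, OF x]] one_minus_square_pos[OF x] assms by simp
  ultimately show "is_solution \<nu> c U" unfolding is_solution_def by blast
qed

text \<open>The substitution \<open>Y = U + 2 * \<nu> * x\<close> completes the square and removes the linear term of the
  equation, at the price of replacing \<open>P c\<close> by \<open>P c + 2 * \<nu>\<^sup>2\<close>.\<close>

lemma is_solution_shift_iff:
  assumes "\<nu> > 0"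
  shows "is_solution \<nu> c U \<longleftrightarrow> (\<forall>x\<in>{-1<..<1}. ((\<lambda>x. U x + 2 * \<nu> * x) has_real_derivative
    (P c x + 2 * \<nu>\<^sup>2 - (U x + 2 * \<nu> * x)\<^sup>2 / 2) / (\<nu> * (1 - x\<^sup>2))) (at x))"
proof -
  have "(U has_real_derivative (P c x - 2 * \<nu> * x * U x - (U x)\<^sup>2 / 2) / (\<nu> * (1 - x\<^sup>2))) (at x)
    \<longleftrightarrow> ((\<lambda>x. U x + 2 * \<nu> * x) has_real_derivative
    (P c x + 2 * \<nu>\<^sup>2 - (U x + 2 * \<nu> * x)\<^sup>2 / 2) / (\<nu> * (1 - x\<^sup>2))) (at x)"
    (is "(U has_real_derivative ?a) _ \<longleftrightarrow> (_ has_real_derivative ?b) _")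
    if x: "x \<in> {-1<..<1}" for x
  proof -
    have nz: "\<nu> * (1 - x\<^sup>2) \<noteq> 0" using one_minus_square_pos[OF x] assms by simp
    have "P c x + 2 * \<nu>\<^sup>2 - (U x + 2 * \<nu> * x)\<^sup>2 / 2 =
        (P c x - 2 * \<nu> * x * U x - (U x)\<^sup>2 / 2) + 2 * \<nu> * (\<nu> * (1 - x\<^sup>2))"
      by (simp add: power2_eq_square field_simps)
    then have b: "?b = ?a + 2 * \<nu>"
      using nz by (simp only: add_divide_distrib) simp
    have lin: "((\<lambda>x. 2 * \<nu> * x) has_real_derivative 2 * \<nu>) (at x)"
      by (rule DERIV_cmult_Id)
    show ?thesis
    proof
      assume "(U has_real_derivative ?a) (at x)"
      then show "((\<lambda>x. U x + 2 * \<nu> * x) has_real_derivative ?b) (at x)"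
        unfolding b by (rule DERIV_add[OF _ lin])
    next
      assume "((\<lambda>x. U x + 2 * \<nu> * x) has_real_derivative ?b) (at x)"
      from DERIV_diff[OF this lin] show "(U has_real_derivative ?a) (at x)"
        unfolding b by simp
    qed
  qed
  then show ?thesis unfolding is_solution_iff[OF assms] by blast
qed

text \<open>Were the shifted solution bounded above by \<open>- \<eta>\<close> near \<open>x = -1\<close>, adding \<open>1 / z\<close> with a positive
  solution \<open>z\<close> of the associated linear equation would produce a strictly greater solution.\<close>

lemma greatest_solution_not_below:
  assumes up: "is_upper_solution \<nu> c U" and "\<nu> > 0" "\<eta> > 0"
  shows "\<exists>t<T. U (tanh t) + 2 * \<nu> * tanh t > - \<eta>"
proof (rule ccontr)
  assume "\<not> ?thesis"
  then have neg: "U (tanh t) + 2 * \<nu> * tanh t \<le> - \<eta>" if "t \<le> T - 1" for t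
    using that by (smt (verit))
  define Y where "Y x = U x + 2 * \<nu> * x" for x
  define q where "q x = (P c x + 2 * \<nu>\<^sup>2 - (Y x)\<^sup>2 / 2) / (\<nu> * (1 - x\<^sup>2))" for x
  have dY: "(Y has_real_derivative q x) (at x)" if "x \<in> {-1<..<1}" for x
    using up that \<open>\<nu> > 0\<close>
    unfolding is_upper_solution_def is_solution_shift_iff[OF \<open>\<nu> > 0\<close>] Y_def q_def by blast
  have "continuous_on UNIV (\<lambda>t. Y (tanh t))"
    using has_deriv_comp_tanh[of Y q, OF dY] DERIV_isCont continuous_at_imp_continuous_on by blast
  then obtain z where z: "\<And>t. z t > 0"
    "\<And>t. (z has_real_derivative (Y (tanh t) * z t + 1 / 2) / \<nu>) (at t)"
    using positive_global_linear_solution[OF \<open>\<nu> > 0\<close> \<open>\<eta> > 0\<close>, of "\<lambda>t. Y (tanh t)" "T - 1"] neg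
    unfolding Y_def by blast
  define V where "V x = U x + inverse (z (artanh x))" for x
  have "is_solution \<nu> c V"
    unfolding is_solution_shift_iff[OF \<open>\<nu> > 0\<close>]
  proof
    fix x :: real assume x: "x \<in> {-1<..<1}"
    have nz: "\<nu> * (1 - x\<^sup>2) \<noteq> 0" using one_minus_square_pos[OF x] \<open>\<nu> > 0\<close> by simp
    let ?z = "z (artanh x)"
    have "((\<lambda>x. z (artanh x)) has_real_derivative
        (Y (tanh (artanh x)) * ?z + 1 / 2) / \<nu> * (1 / (1 - x\<^sup>2))) (at x)"
      by (rule DERIV_chain2[OF z(2)]) (use x in \<open>auto intro!: derivative_eq_intros\<close>)
    then have dz: "((\<lambda>x. z (artanh x)) has_real_derivative
        (Y x * ?z + 1 / 2) / (\<nu> * (1 - x\<^sup>2))) (at x)"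
      using x by (simp add: tanh_artanh_real)
    have "((\<lambda>x. Y x + inverse (z (artanh x))) has_real_derivative
        q x + - (inverse ?z * ((Y x * ?z + 1 / 2) / (\<nu> * (1 - x\<^sup>2))) * inverse ?z)) (at x)"
      by (intro DERIV_add dY[OF x] DERIV_inverse' dz) (use z(1)[of "artanh x"] in simp)
    moreover have "q x + - (inverse ?z * ((Y x * ?z + 1 / 2) / (\<nu> * (1 - x\<^sup>2))) * inverse ?z)
        = (P c x + 2 * \<nu>\<^sup>2 - (Y x + inverse ?z)\<^sup>2 / 2) / (\<nu> * (1 - x\<^sup>2))"
    proof -
      have "(Y x + inverse ?z)\<^sup>2 / 2 = (Y x)\<^sup>2 / 2 + inverse ?z * (Y x * ?z + 1 / 2) * inverse ?z"
        using z(1)[of "artanh x"] by (simp add: power2_eq_square field_simps)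
      then have "P c x + 2 * \<nu>\<^sup>2 - (Y x + inverse ?z)\<^sup>2 / 2 =
          P c x + 2 * \<nu>\<^sup>2 - (Y x)\<^sup>2 / 2 - inverse ?z * (Y x * ?z + 1 / 2) * inverse ?z"
        by linarith
      moreover have "A / k + - (i * (b / k) * i) = (A - i * b * i) / k" for A i b k :: real
        by (simp add: diff_divide_distrib)
      ultimately show ?thesis unfolding q_def by presburger
    qed
    ultimately show "((\<lambda>x. V x + 2 * \<nu> * x) has_real_derivative
        (P c x + 2 * \<nu>\<^sup>2 - (V x + 2 * \<nu> * x)\<^sup>2 / 2) / (\<nu> * (1 - x\<^sup>2))) (at x)"
      by (simp add: V_def Y_def add_ac)
  qed
  then have "V 0 \<le> U 0" using up by (simp add: is_upper_solution_def)
  then show False using z(1)[of "artanh 0"] by (simp add: V_def)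
qed

section \<open>Reflection\<close>

text \<open>The parameter of the reflected problem: \<open>x \<mapsto> - x\<close> exchanges the two end points and, combined
  with \<open>U \<mapsto> - U\<close>, exchanges greatest and least solutions.\<close>

definition swap_ends :: "real ^ 3 \<Rightarrow> real ^ 3" where
  "swap_ends c = vector [c $ 2, c $ 1, c $ 3]"

lemma P_swap_ends: "P (swap_ends c) x = P c (- x)"
  by (simp add: P_def swap_ends_def vector_3)

lemma is_solution_reflect:
  assumes "\<nu> > 0" "is_solution \<nu> c U" and P: "\<And>x. P c' x = P c (- x)"
  shows "is_solution \<nu> c' (\<lambda>x. - U (- x))"
  unfolding is_solution_iff[OF assms(1)]
proof
  fix x :: real assume x: "x \<in> {-1<..<1}"
  have "(U has_real_derivative (P c (-x) - 2 * \<nu> * (-x) * U (-x) - (U (-x))\<^sup>2 / 2)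
      / (\<nu> * (1 - (-x)\<^sup>2))) (at (- x))"
    by (rule bspec[OF assms(2)[unfolded is_solution_iff[OF assms(1)]]]) (use x in auto)
  then have "((\<lambda>x. U (- x)) has_real_derivative (P c (-x) - 2 * \<nu> * (-x) * U (-x) - (U (-x))\<^sup>2 / 2)
      / (\<nu> * (1 - (-x)\<^sup>2)) * (- 1)) (at x)"
    by (rule DERIV_chain2) (auto intro!: derivative_eq_intros)
  from DERIV_minus[OF this] show "((\<lambda>x. - U (- x)) has_real_derivative
      (P c' x - 2 * \<nu> * x * - U (- x) - (- U (- x))\<^sup>2 / 2) / (\<nu> * (1 - x\<^sup>2))) (at x)"
    by (simp add: P)
qed

lemma lower_solution_reflect:
  assumes "\<nu> > 0" "is_lower_solution \<nu> c U"
  shows "is_upper_solution \<nu> (swap_ends c) (\<lambda>x. - U (- x))"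
  unfolding is_upper_solution_def
proof (intro conjI allI impI ballI)
  show "is_solution \<nu> (swap_ends c) (\<lambda>x. - U (- x))"
    using assms P_swap_ends unfolding is_lower_solution_def by (blast intro: is_solution_reflect)
  fix V and x :: real
  assume V: "is_solution \<nu> (swap_ends c) V" and x: "x \<in> {-1<..<1}"
  have "is_solution \<nu> c (\<lambda>x. - V (- x))"
    by (rule is_solution_reflect[OF assms(1) V]) (simp add: P_swap_ends)
  then have "U (- x) \<le> - V (- (- x))"
    using assms(2) x unfolding is_lower_solution_def by fastforce
  then show "V x \<le> - U (- x)" by simp
qed

lemma smooth_on_reflect:
  assumes "open S" "\<And>x. x \<in> S \<Longrightarrow> - x \<in> S" "smooth_on S f"
  shows "smooth_on S (\<lambda>x. f (- x))"
proof -
  have "ndiff n S (\<lambda>x. f (- x))" if "smooth_on S f" for n f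
    using that
  proof (induction n arbitrary: f)
    case (Suc n)
    show ?case
    proof (rule ndiff_SucI[OF assms(1)])
      show "((\<lambda>x. f (- x)) has_real_derivative (- 1) * deriv f (- x)) (at x)" if "x \<in> S" for x
      proof -
        have "((\<lambda>x. f (- x)) has_real_derivative deriv f (- x) * (- 1)) (at x)"
          by (rule DERIV_chain2[where f = f and g = uminus])
            (auto intro!: derivative_eq_intros smooth_on_has_deriv[OF Suc.prems] assms(2) that)
        then show ?thesis by simp
      qed
      show "ndiff n S (\<lambda>x. (- 1) * deriv f (- x))"
        by (intro ndiff_mult[OF assms(1)] ndiff_const[OF assms(1)] Suc.IH smooth_on_deriv Suc.prems)
    qed
  qed simp
  then show ?thesis using assms(3) by (simp add: smooth_on_def)
qed

lemma funpow_deriv_reflect: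
  assumes "open S" "\<And>x. x \<in> S \<Longrightarrow> - x \<in> S" "smooth_on S f"
  shows "x \<in> S \<Longrightarrow> (deriv ^^ j) (\<lambda>x. - f (- x)) x = - ((- 1) ^ j * (deriv ^^ j) f (- x))"
proof (induction j arbitrary: x)
  case (Suc j)
  have "(deriv ^^ Suc j) (\<lambda>x. - f (- x)) x = deriv (\<lambda>x. - ((- 1) ^ j * (deriv ^^ j) f (- x))) x"
    using deriv_cong_open[OF assms(1) Suc.IH Suc.prems] by simp
  also have "\<dots> = - ((- 1) ^ j * (deriv ((deriv ^^ j) f) (- x) * (- 1)))"
    by (intro DERIV_imp_deriv DERIV_minus DERIV_cmult DERIV_chain2[where g = uminus]
        smooth_on_has_deriv[OF smooth_on_funpow[OF assms(3)]] assms(2) Suc.prems)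
      (auto intro!: derivative_eq_intros)
  finally show ?case by simp
qed simp

section \<open>The norms\<close>

lemma smooth_on_continuous: "smooth_on S f \<Longrightarrow> continuous_on S f"
  using smooth_on_has_deriv by (meson DERIV_isCont continuous_at_imp_continuous_on)

lemma Linf_norm_le:
  assumes "continuous_on S f" "S \<in> sets lebesgue" "\<And>x. x \<in> S \<Longrightarrow> \<bar>f x\<bar> \<le> B"
  shows "Linf_norm S f \<le> ennreal B"
  unfolding Linf_norm_def
proof (rule esssup_I)
  have "f \<in> borel_measurable (lebesgue_on S)"
    using assms by (intro continuous_imp_measurable_on_sets_lebesgue)
  then show "(\<lambda>x. ennreal \<bar>f x\<bar>) \<in> borel_measurable (lebesgue_on S)" by measurable
  show "AE x in lebesgue_on S. ennreal \<bar>f x\<bar> \<le> ennreal B"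
    using assms(3) by (intro AE_I2) (auto simp: space_restrict_space intro!: ennreal_leI)
qed

text \<open>A bound on one more derivative makes each derivative up to order \<open>m\<close> Lipschitz, and a Lipschitz
  function extends continuously to the closed interval.\<close>

lemma Cm_on_closed_if_bounded_derivs:
  assumes f: "smooth_on {l<..<u} f" and "l \<le> a" "b \<le> u"
    and bnd: "\<And>j x. j \<le> Suc m \<Longrightarrow> x \<in> {l<..<u} \<Longrightarrow> \<bar>(deriv ^^ j) f x\<bar> \<le> B"
  shows "Cm_on_closed m a b f"
  unfolding Cm_on_closed_def
proof (intro conjI allI impI)
  have sub: "{a<..<b} \<subseteq> {l<..<u}" using assms by auto
  have d: "((deriv ^^ j) f has_real_derivative (deriv ^^ Suc j) f x) (at x)" if "x \<in> {l<..<u}" for j x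
    using smooth_on_has_deriv[OF smooth_on_funpow[OF f] that] by simp
  show "(deriv ^^ j) f differentiable_on {a<..<b}" for j
    unfolding differentiable_on_def
    using d sub by (meson differentiableI differentiable_at_withinI has_field_derivative_imp_has_derivative subsetD)
  fix j assume j: "j \<le> m"
  show "\<exists>g. continuous_on {a..b} g \<and> (\<forall>x\<in>{a<..<b}. g x = (deriv ^^ j) f x)"
  proof (cases "a < b")
    case True
    have "B-lipschitz_on {l<..<u} ((deriv ^^ j) f)"
    proof (rule lipschitz_onI)
      have "l < u" using True assms by simp
      then obtain x where "x \<in> {l<..<u}" using dense by auto
      then show "B \<ge> 0" using bnd[of 0 x] by simp
      show "dist ((deriv ^^ j) f x) ((deriv ^^ j) f y) \<le> B * dist x y"
        if "x \<in> {l<..<u}" "y \<in> {l<..<u}" for x y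
        unfolding dist_norm
        by (rule field_differentiable_bound[where S = "{l<..<u}" and f' = "(deriv ^^ Suc j) f"])
          (use that d bnd[of "Suc j"] j in \<open>auto intro: has_field_derivative_at_within\<close>)
    qed
    then have "uniformly_continuous_on {l<..<u} ((deriv ^^ j) f)"
      by (rule lipschitz_on_uniformly_continuous)
    then obtain g where g: "uniformly_continuous_on (closure {l<..<u}) g"
      "\<And>x. x \<in> {l<..<u} \<Longrightarrow> (deriv ^^ j) f x = g x"
      using uniformly_continuous_on_extension_on_closure by metis
    have "{a..b} \<subseteq> closure {l<..<u}" using True assms by simp
    then have "continuous_on {a..b} g"
      using g(1) uniformly_continuous_imp_continuous continuous_on_subset by blast
    then show ?thesis using g(2) sub by (intro exI[of _ g]) auto
  next
    case False
    then show ?thesis by (intro exI[of _ "\<lambda>x. 0"]) auto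
  qed
qed

lemma Cm_norm_le:
  assumes f: "smooth_on {l<..<u} f" and "l \<le> a" "b \<le> u" and "B \<ge> 0"
    and bnd: "\<And>j x. j \<le> Suc m \<Longrightarrow> x \<in> {l<..<u} \<Longrightarrow> \<bar>(deriv ^^ j) f x\<bar> \<le> B"
  shows "Cm_norm m a b f \<le> ennreal (real (Suc m) * B)"
proof -
  have "Cm_norm m a b f = (\<Sum>j\<le>m. (SUP x\<in>{a<..<b}. ennreal \<bar>(deriv ^^ j) f x\<bar>))"
    using Cm_on_closed_if_bounded_derivs[OF f assms(2,3) bnd] by (simp add: Cm_norm_def)
  also have "\<dots> \<le> (\<Sum>j\<le>m. ennreal B)"
  proof (intro sum_mono SUP_least ennreal_leI)
    fix j x assume "j \<in> {..m}" "x \<in> {a<..<b}"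
    then show "\<bar>(deriv ^^ j) f x\<bar> \<le> B" using assms(2,3) by (intro bnd) auto
  qed
  also have "\<dots> = ennreal (real (Suc m) * B)"
    using \<open>B \<ge> 0\<close> by (subst sum_ennreal) auto
  finally show ?thesis .
qed

section \<open>Positivity of P on the interior of J 0\<close>

text \<open>At the lower boundary of \<open>J 0\<close>, with \<open>a = sqrt (c $ 1)\<close> and \<open>b = sqrt (c $ 2)\<close>, the polynomial is
  the square \<open>(a * (1 - x) - b * (1 + x))\<^sup>2 / 2\<close>, and \<open>P c x\<close> increases with \<open>c $ 3\<close>.\<close>

lemma P_nonneg_on_J0:
  assumes "c \<in> J 0" "x \<in> {-1<..<1}"
  shows "P c x \<ge> 0"
proof -
  define a where "a = sqrt (c $ 1)"
  define b where "b = sqrt (c $ 2)"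
  have c: "c $ 1 = a\<^sup>2" "c $ 2 = b\<^sup>2" "c $ 3 \<ge> - (1 / 2) * (a + b)\<^sup>2"
    using assms(1) by (auto simp: J_def cbar3_def a_def b_def power2_eq_square)
  have "(- (1 / 2) * (a + b)\<^sup>2) * (1 - x\<^sup>2) \<le> c $ 3 * (1 - x\<^sup>2)"
    using c(3) one_minus_square_pos[OF assms(2)] by (intro mult_right_mono) auto
  moreover have "a\<^sup>2 * (1 - x) + b\<^sup>2 * (1 + x) + (- (1 / 2) * (a + b)\<^sup>2) * (1 - x\<^sup>2)
      = (a * (1 - x) - b * (1 + x))\<^sup>2 / 2"
    by (simp add: power2_eq_square field_simps)
  moreover have "(a * (1 - x) - b * (1 + x))\<^sup>2 \<ge> 0" by simp
  ultimately show ?thesis unfolding P_def c(1,2) by linarith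
qed

text \<open>Lowering all three coefficients of \<open>c\<close> by a small \<open>h\<close> does not leave \<open>J 0\<close>, and it lowers \<open>P c x\<close>
  by \<open>h * (2 + (1 - x\<^sup>2)) \<ge> 2 * h\<close>.\<close>

lemma P_pos_on_interior_J0:
  assumes "c \<in> interior (J 0)"
  obtains h where "h > 0" "\<And>x. x \<in> {-1<..<1} \<Longrightarrow> P c x \<ge> 2 * h"
proof -
  obtain e where e: "e > 0" "ball c e \<subseteq> J 0"
    using assms mem_interior by blast
  define h where "h = e / 4"
  define d :: "real ^ 3" where "d = c - h *\<^sub>R (\<chi> i. 1)"
  have "norm ((\<chi> i. 1) :: real ^ 3) = sqrt 3"
    by (simp add: norm_vec_def L2_set_def)
  moreover have "sqrt 3 < 2" by (rule real_less_lsqrt) auto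
  ultimately have "dist c d < e"
    using e(1) by (simp add: d_def dist_norm h_def)
  then have "d \<in> J 0" using e(2) by auto
  have "P c x \<ge> 2 * h" if x: "x \<in> {-1<..<1}" for x
  proof -
    have "P c x = P d x + h * (1 - x) + h * (1 + x) + h * (1 - x\<^sup>2)"
      by (simp add: P_def d_def algebra_simps)
    moreover have "h * (1 - x\<^sup>2) \<ge> 0"
      using one_minus_square_pos[OF x] e(1) by (simp add: h_def)
    ultimately show ?thesis
      using P_nonneg_on_J0[OF \<open>d \<in> J 0\<close> x] by (simp add: algebra_simps)
  qed
  moreover have "h > 0" using e(1) by (simp add: h_def)
  ultimately show ?thesis using that by blast
qed

lemma P_diff_le:
  assumes "x \<in> {-1<..<1}"
  shows "\<bar>P c x - P d x\<bar> \<le> 5 * norm (c - d)"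
proof -
  have i: "\<bar>c $ i - d $ i\<bar> \<le> norm (c - d)" for i
    using component_le_norm_cart[of "c - d" i] by simp
  have x: "0 \<le> 1 - x\<^sup>2" "1 - x\<^sup>2 \<le> 1" using one_minus_square_pos[OF assms] by auto
  have "P c x - P d x = (c $ 1 - d $ 1) * (1 - x) + (c $ 2 - d $ 2) * (1 + x)
      + (c $ 3 - d $ 3) * (1 - x\<^sup>2)"
    by (simp add: P_def algebra_simps)
  moreover have "\<bar>(c $ 1 - d $ 1) * (1 - x)\<bar> \<le> norm (c - d) * 2"
    unfolding abs_mult using assms by (intro mult_mono i) auto
  moreover have "\<bar>(c $ 2 - d $ 2) * (1 + x)\<bar> \<le> norm (c - d) * 2"
    unfolding abs_mult using assms by (intro mult_mono i) auto
  moreover have "\<bar>(c $ 3 - d $ 3) * (1 - x\<^sup>2)\<bar> \<le> norm (c - d) * 1"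
    unfolding abs_mult using x by (intro mult_mono i) auto
  ultimately show ?thesis by linarith
qed

lemma P_scaleR: "P (a *\<^sub>R c) x = a * P c x"
  by (simp add: P_def algebra_simps)

section \<open>Uniform estimate for upper solutions\<close>

text \<open>The family for which the estimates are uniform. The number \<open>s\<close> stands for \<open>sqrt (norm c)\<close>: the
  problem is invariant under scaling \<open>\<nu>\<close> and \<open>U\<close> by \<open>s\<close> and \<open>c\<close> by \<open>s\<^sup>2\<close>, so only \<open>\<nu> / s\<close> has to be
  small, and \<open>\<delta>\<close> measures how far \<open>c / s\<^sup>2\<close> is from the degenerate case where \<open>P c\<close> vanishes.\<close>

definition upper_data :: "real \<Rightarrow> real \<Rightarrow> (real \<times> real \<times> (real ^ 3) \<times> (real \<Rightarrow> real)) set" where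
  "upper_data \<delta> \<kappa> = {(\<nu>, s, c, U). 0 < \<nu> \<and> 0 < s \<and> \<nu> \<le> \<kappa> * s \<and> (\<forall>i. \<bar>c $ i\<bar> \<le> s\<^sup>2) \<and>
     (\<forall>x\<in>{-1<..<1}. (\<delta> * s)\<^sup>2 \<le> 2 * P c x) \<and> is_upper_solution \<nu> c U}"

lemma sqrt_P_O:
  assumes "\<delta> > 0"
  shows "unif_O {-1<..<1} (upper_data \<delta> \<kappa>) n (\<lambda>(\<nu>, s, c, U). s) (\<lambda>(\<nu>, s, c, U) x. sqrt (2 * P c x))"
proof -
  let ?S = "{-1<..<1::real}" and ?Q = "upper_data \<delta> \<kappa>"
  let ?s = "\<lambda>p. fst (snd p)" and ?c = "\<lambda>p. fst (snd (snd p))"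
  have S: "open ?S" by simp
  have c: "unif_O ?S ?Q n (\<lambda>p. (?s p)\<^sup>2) (\<lambda>p x. ?c p $ i)" for i n
    by (rule unif_O_const[OF S, where K = 1]) (auto simp: upper_data_def)
  have one: "unif_O ?S ?Q n (\<lambda>p. 1) (\<lambda>p x. a)" for n a
    by (rule unif_O_const[OF S, where K = "\<bar>a\<bar>"]) simp
  have x: "unif_O ?S ?Q n (\<lambda>p. 1) (\<lambda>p x. x)" for n by (rule unif_O_ident)
  have xx: "unif_O ?S ?Q n (\<lambda>p. 1) (\<lambda>p x. x * x)" for n
    using unif_O_mult[OF S x x] by simp
  have "unif_O ?S ?Q n (\<lambda>p. 1 * ((?s p)\<^sup>2 * 1)) (\<lambda>p x. 2 *
      (?c p $ 1 * (1 - x) + ?c p $ 2 * (1 + x) + ?c p $ 3 * (1 - x * x)))" for n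
    by (intro unif_O_mult[OF S] unif_O_add[OF S] unif_O_diff[OF S] c one x xx)
  then have "unif_O ?S ?Q n (\<lambda>p. (?s p)\<^sup>2) (\<lambda>p x. 2 * P (?c p) x)" for n
    by (simp add: P_def power2_eq_square)
  moreover have "\<delta> * ?s p \<le> sqrt (2 * P (?c p) x)" if "p \<in> ?Q" "x \<in> ?S" for p x
    using that by (intro real_le_rsqrt) (auto simp: upper_data_def)
  ultimately have "unif_O ?S ?Q n ?s (\<lambda>p x. sqrt (2 * P (?c p) x))"
    using assms by (intro unif_O_sqrt[OF S, where d = \<delta>]) (auto simp: upper_data_def)
  then show ?thesis by (simp add: case_prod_unfold)
qed

text \<open>In the variable \<open>t = artanh x\<close> the shifted equation is \<open>\<nu> y' = w\<^sup>2 / 2 + 2\<nu>\<^sup>2 - y\<^sup>2 / 2\<close> on the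
  whole line. Every global solution satisfies the upper bound; the lower bound uses that the solution
  is the greatest one.\<close>

lemma upper_solution_close:
  assumes "\<delta> > 0" and p: "(\<nu>, s, c, U) \<in> upper_data \<delta> \<kappa>" and "\<kappa> \<le> 1" and "K \<ge> 0"
    and W: "\<And>x. x \<in> {-1<..<1} \<Longrightarrow> sqrt (2 * P c x) \<le> K * s"
    and W': "\<And>x. x \<in> {-1<..<1} \<Longrightarrow> ((\<lambda>x. sqrt (2 * P c x)) has_real_derivative w' x) (at x)"
    and w': "\<And>x. x \<in> {-1<..<1} \<Longrightarrow> \<bar>w' x\<bar> \<le> K * s"
    and x: "x \<in> {-1<..<1}"
  shows "\<bar>(U x + 2 * \<nu> * x) - sqrt (2 * P c x)\<bar> \<le> 4 * (K + 1) / \<delta> * \<nu>"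
proof -
  have \<nu>: "\<nu> > 0" and s: "s > 0" and low: "\<And>x. x \<in> {-1<..<1} \<Longrightarrow> (\<delta> * s)\<^sup>2 \<le> 2 * P c x"
    and up: "is_upper_solution \<nu> c U" and \<nu>s: "\<nu> \<le> \<kappa> * s"
    using p by (auto simp: upper_data_def)
  have "\<kappa> * s \<le> 1 * s" using \<open>\<kappa> \<le> 1\<close> s by (intro mult_right_mono) auto
  then have "\<nu> \<le> s" using \<nu>s by simp
  define y where "y t = U (tanh t) + 2 * \<nu> * tanh t" for t
  define w where "w t = sqrt (2 * P c (tanh t))" for t
  define y' where "y' t = (P c (tanh t) + 2 * \<nu>\<^sup>2 - (y t)\<^sup>2 / 2) / \<nu>" for t
  have sq: "1 - (tanh t)\<^sup>2 > 0" for t :: real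
    by (rule one_minus_square_pos[OF tanh_real_bounds])
  have dy: "(y has_real_derivative y' t) (at t)" for t
  proof -
    have "((\<lambda>t. U (tanh t) + 2 * \<nu> * tanh t) has_real_derivative
      (P c (tanh t) + 2 * \<nu>\<^sup>2 - (U (tanh t) + 2 * \<nu> * tanh t)\<^sup>2 / 2) / (\<nu> * (1 - (tanh t)\<^sup>2))
        * (1 - (tanh t)\<^sup>2)) (at t)"
      by (rule has_deriv_comp_tanh)
        (use up in \<open>auto simp: is_upper_solution_def is_solution_shift_iff[OF \<nu>]\<close>)
    then show ?thesis using sq[of t] by (simp add: y_def[abs_def] y'_def)
  qed
  have dw: "(w has_real_derivative w' (tanh t) * (1 - (tanh t)\<^sup>2)) (at t)" for t
    unfolding w_def by (rule has_deriv_comp_tanh[OF W'])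
  have w2: "(w t)\<^sup>2 / 2 = P c (tanh t)" for t
    using order_trans[OF zero_le_power2 low[OF tanh_real_bounds[of t]]] by (simp add: w_def)
  have eq: "\<nu> * y' t = (w t)\<^sup>2 / 2 + 2 * \<nu>\<^sup>2 - (y t)\<^sup>2 / 2" for t
    unfolding w2 y'_def using \<nu> by simp
  have wl: "\<delta> * s \<le> w t" for t
    unfolding w_def by (rule real_le_rsqrt[OF low[OF tanh_real_bounds]])
  have wh: "w t \<le> K * s" for t
    unfolding w_def by (rule W[OF tanh_real_bounds])
  have wb: "\<bar>w' (tanh t) * (1 - (tanh t)\<^sup>2)\<bar> \<le> K * s" for t :: real
  proof -
    have "\<bar>w' (tanh t)\<bar> * \<bar>1 - (tanh t)\<^sup>2\<bar> \<le> (K * s) * 1"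
      using sq[of t] by (intro mult_mono w' tanh_real_bounds) (use \<open>K \<ge> 0\<close> s in auto)
    then show ?thesis by (simp add: abs_mult)
  qed
  define t where "t = artanh x"
  have tx: "tanh t = x" using x by (simp add: t_def tanh_artanh_real)
  have "y t \<le> w t + (K + 2) / \<delta> * \<nu>"
    by (rule riccati_upper_bound[OF \<nu> \<open>\<nu> \<le> s\<close> \<open>\<delta> > 0\<close> \<open>K \<ge> 0\<close> dy dw eq wl wb])
  moreover have "(K + 2) / \<delta> * \<nu> \<le> 4 * (K + 1) / \<delta> * \<nu>"
    using \<open>\<delta> > 0\<close> \<open>K \<ge> 0\<close> \<nu> by (intro mult_right_mono divide_right_mono) auto
  moreover have "y t \<ge> w t - 4 * (K + 1) / \<delta> * \<nu>"
  proof (rule riccati_lower_bound[OF \<nu> s \<open>\<delta> > 0\<close> \<open>K \<ge> 0\<close> dy dw eq wl wh wb])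
    show "\<exists>t<T. - (\<delta> * s / 2) < y t" for T
      unfolding y_def using \<open>\<delta> > 0\<close> s by (intro greatest_solution_not_below[OF up \<nu>]) simp
  qed
  ultimately show ?thesis by (simp add: y_def w_def tx abs_le_iff)
qed

text \<open>The order in which the constants are chosen matters: \<open>K\<close> bounds the slow curve over the family with
  \<open>\<kappa> = 1\<close>, it determines the constant \<open>C\<close> of the uniform estimate, and \<open>\<kappa>\<close> is then chosen small
  in terms of \<open>C\<close> and \<open>N\<close>.\<close>

lemma upper_solution_O:
  assumes "\<delta> > 0"
  obtains \<kappa> where "\<kappa> > 0" "unif_O {-1<..<1} (upper_data \<delta> \<kappa>) N (\<lambda>(\<nu>, s, c, U). \<nu>)
    (\<lambda>(\<nu>, s, c, U) x. U x - sqrt (2 * P c x))"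
proof -
  let ?S = "{-1<..<1::real}"
  have S: "open ?S" by simp
  let ?\<nu> = "\<lambda>(\<nu>, s, c, U). \<nu>" and ?s = "\<lambda>(\<nu>, s, c, U). s"
  let ?W = "\<lambda>(\<nu>, s, c, U) x. sqrt (2 * P c x)" and ?Y = "\<lambda>(\<nu>, s, c, U) x. U x + 2 * \<nu> * x"
  obtain K where K: "K \<ge> 0" "\<And>p j x. p \<in> upper_data \<delta> 1 \<Longrightarrow> j \<le> 1 \<Longrightarrow> x \<in> ?S \<Longrightarrow>
      \<bar>(deriv ^^ j) (?W p) x\<bar> \<le> K * \<bar>?s p\<bar>"
    using unif_O_boundE[OF S sqrt_P_O[OF assms, of 1 1]] by metis
  define C where "C = 4 * (K + 1) / \<delta>"
  have C: "C > 0" using K(1) assms by (simp add: C_def)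
  define \<kappa> where "\<kappa> = min 1 (\<delta> / (2 * C + 4 * N + 8))"
  have \<kappa>: "\<kappa> > 0" "\<kappa> \<le> 1" "(2 * C + 4 * N + 8) * \<kappa> \<le> \<delta>"
  proof -
    have k: "2 * C + 4 * N + 8 > 0" using C by (simp add: add_pos_nonneg)
    then show "\<kappa> > 0" "\<kappa> \<le> 1" using assms by (auto simp: \<kappa>_def)
    have "\<kappa> \<le> \<delta> / (2 * C + 4 * N + 8)" by (simp add: \<kappa>_def)
    then show "(2 * C + 4 * N + 8) * \<kappa> \<le> \<delta>"
      using k by (simp only: pos_le_divide_eq mult.commute)
  qed
  let ?Q = "upper_data \<delta> \<kappa>"
  have sub: "?Q \<subseteq> upper_data \<delta> 1"
  proof
    fix p assume p: "p \<in> ?Q"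
    obtain \<nu> s c U where pe: "p = (\<nu>, s, c, U)" using prod_cases4 by blast
    have "\<kappa> * s \<le> 1 * s" using p \<kappa>(2) by (intro mult_right_mono) (auto simp: pe upper_data_def)
    moreover have "\<nu> \<le> \<kappa> * s" using p by (simp add: pe upper_data_def)
    ultimately have "\<nu> \<le> 1 * s" by (rule order_trans[rotated])
    then show "p \<in> upper_data \<delta> 1" using p by (simp add: pe upper_data_def)
  qed
  have W: "unif_O ?S ?Q n ?s ?W" for n by (rule sqrt_P_O[OF assms])
  interpret riccati_family ?Q ?\<nu> ?s ?W ?Y \<delta> C N
  proof
    fix p x assume p: "p \<in> ?Q"
    obtain \<nu> s c U where pe: "p = (\<nu>, s, c, U)" using prod_cases4 by blast
    have d: "\<nu> > 0" "s > 0" "\<nu> \<le> \<kappa> * s" "is_upper_solution \<nu> c U"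
      "\<And>x. x \<in> ?S \<Longrightarrow> (\<delta> * s)\<^sup>2 \<le> 2 * P c x"
      using p by (auto simp: pe upper_data_def)
    show "0 < ?\<nu> p" using d by (simp add: pe)
    have "\<kappa> * s \<le> 1 * s" using \<kappa>(2) d by (intro mult_right_mono) auto
    with d(3) have "\<nu> \<le> 1 * s" by (rule order_trans)
    then show "?\<nu> p \<le> ?s p" by (simp add: pe)
    have "(2 * C + 4 * N + 8) * \<nu> \<le> (2 * C + 4 * N + 8) * (\<kappa> * s)"
      using d C by (intro mult_left_mono) auto
    also have "\<dots> \<le> \<delta> * s"
      using mult_right_mono[OF \<kappa>(3), of s] d by (simp add: mult.assoc)
    finally show "(2 * C + 4 * N + 8) * ?\<nu> p \<le> \<delta> * ?s p" by (simp add: pe)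
    fix x assume x: "x \<in> ?S"
    show "\<delta> * ?s p \<le> ?W p x"
      using real_le_rsqrt[OF d(5)[OF x]] by (simp add: pe)
    have "(sqrt (2 * P c x))\<^sup>2 / 2 = P c x"
      using order_trans[OF zero_le_power2 d(5)[OF x]] by simp
    then show "(?Y p has_real_derivative ((?W p x)\<^sup>2 / 2 + 2 * (?\<nu> p)\<^sup>2 - (?Y p x)\<^sup>2 / 2) /
        (?\<nu> p * (1 - x\<^sup>2))) (at x)"
      using d(4) x unfolding is_upper_solution_def is_solution_shift_iff[OF d(1)] pe
      by simp
    have dW: "((\<lambda>x. sqrt (2 * P c x)) has_real_derivative deriv (\<lambda>x. sqrt (2 * P c x)) x) (at x)"
      if "x \<in> ?S" for x
      using smooth_on_has_deriv[OF unif_O_smooth[OF S W p] that] by (simp add: pe)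
    have "\<bar>(U x + 2 * \<nu> * x) - sqrt (2 * P c x)\<bar> \<le> 4 * (K + 1) / \<delta> * \<nu>"
    proof (rule upper_solution_close[OF assms p[unfolded pe] \<kappa>(2) K(1) _ dW _ x])
      show "sqrt (2 * P c x) \<le> K * s" if "x \<in> ?S" for x
        using K(2)[of p 0 x] p sub that d(2) by (auto simp: pe)
      show "\<bar>deriv (\<lambda>x. sqrt (2 * P c x)) x\<bar> \<le> K * s" if "x \<in> ?S" for x
        using K(2)[of p 1 x] p sub that d(2) by (auto simp: pe)
    qed
    then show "\<bar>?Y p x - ?W p x\<bar> \<le> C * ?\<nu> p" by (simp add: pe C_def)
  qed (use assms W in auto)
  have "unif_O ?S ?Q N (\<lambda>p. ?\<nu> p * 1) (\<lambda>p x. (2 * ?\<nu> p) * x)"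
    by (intro unif_O_mult[OF S] unif_O_ident unif_O_const[OF S, where K = 2]) simp
  then have "unif_O ?S ?Q N ?\<nu> (\<lambda>p x. D p x - (2 * ?\<nu> p) * x)"
    by (intro unif_O_diff[OF S] D_O) simp_all
  then have "unif_O ?S ?Q N ?\<nu> (\<lambda>(\<nu>, s, c, U) x. U x - sqrt (2 * P c x))"
    by (rule unif_O_cong[OF S, rotated]) (auto simp: D_def)
  then show ?thesis using that \<kappa>(1) by blast
qed

section \<open>Sequences of parameters\<close>

theorem theorem1p4:
  fixes chat :: "real ^ 3" and \<epsilon> :: real and m :: nat
  assumes "chat \<in> interior (J 0)" and "\<epsilon> > 0" and "m > 0"
  shows "\<exists>C::real. C > 0 \<and>
    (\<forall>(\<nu> :: nat \<Rightarrow> real) (c :: nat \<Rightarrow> real ^ 3)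
      (Up :: nat \<Rightarrow> real \<Rightarrow> real) (Um :: nat \<Rightarrow> real \<Rightarrow> real).
      (\<forall>k. \<nu> k > 0) \<longrightarrow>
      \<nu> \<longlonglongrightarrow> 0 \<longrightarrow>
      (\<forall>k. c k \<in> J (\<nu> k)) \<longrightarrow>
      filterlim (\<lambda>k. norm (c k) / (\<nu> k)\<^sup>2) at_top sequentially \<longrightarrow>
      (\<lambda>k. c k /\<^sub>R norm (c k)) \<longlonglongrightarrow> chat \<longrightarrow>
      (\<forall>k. is_upper_solution (\<nu> k) (c k) (Up k)) \<longrightarrow>
      (\<forall>k. is_lower_solution (\<nu> k) (c k) (Um k)) \<longrightarrow>
      (\<forall>\<^sub>F k in sequentially.
        Linf_norm {-1<..<1} (\<lambda>x. Up k x - sqrt (2 * P (c k) x))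
        + Linf_norm {-1<..<1} (\<lambda>x. Um k x + sqrt (2 * P (c k) x))
          \<le> ennreal (C * \<nu> k) \<and>
        Cm_norm m (-1) (1 - \<epsilon>) (\<lambda>x. Up k x - sqrt (2 * P (c k) x))
        + Cm_norm m (-1 + \<epsilon>) 1 (\<lambda>x. Um k x + sqrt (2 * P (c k) x))
          \<le> ennreal (C * \<nu> k)))"
proof -
  obtain h where h: "h > 0" "\<And>x. x \<in> {-1<..<1} \<Longrightarrow> P chat x \<ge> 2 * h"
    by (rule P_pos_on_interior_J0[OF assms(1)], rule that)
  define \<delta> where "\<delta> = sqrt (2 * h)"
  have \<delta>: "\<delta> > 0" "\<delta>\<^sup>2 = 2 * h" using h(1) by (auto simp: \<delta>_def)
  let ?S = "{-1<..<1::real}"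
  have S: "open ?S" by simp
  obtain \<kappa> where \<kappa>: "\<kappa> > 0" and O: "unif_O ?S (upper_data \<delta> \<kappa>) (Suc m) (\<lambda>(\<nu>, s, c, U). \<nu>)
    (\<lambda>(\<nu>, s, c, U) x. U x - sqrt (2 * P c x))"
    by (rule upper_solution_O[OF \<delta>(1)], rule that)
  obtain B where B: "B \<ge> 0" "\<And>p j x. p \<in> upper_data \<delta> \<kappa> \<Longrightarrow> j \<le> Suc m \<Longrightarrow> x \<in> ?S \<Longrightarrow>
      \<bar>(deriv ^^ j) ((\<lambda>(\<nu>, s, c, U) x. U x - sqrt (2 * P c x)) p) x\<bar> \<le> B * \<bar>(\<lambda>(\<nu>, s, c, U). \<nu>) p\<bar>"
    by (rule unif_O_boundE[OF S O], rule that)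
  have norms: "Linf_norm ?S f \<le> ennreal (B * \<nu>)"
    "-1 \<le> a \<Longrightarrow> b \<le> 1 \<Longrightarrow> Cm_norm m a b f \<le> ennreal (real (Suc m) * (B * \<nu>))"
    if "smooth_on ?S f" "\<nu> > 0" "\<And>j x. j \<le> Suc m \<Longrightarrow> x \<in> ?S \<Longrightarrow> \<bar>(deriv ^^ j) f x\<bar> \<le> B * \<nu>"
    for f \<nu> a b
  proof -
    show "Linf_norm ?S f \<le> ennreal (B * \<nu>)"
      by (rule Linf_norm_le[OF smooth_on_continuous[OF that(1)]]) (use that(3)[of 0] in auto)
    show "Cm_norm m a b f \<le> ennreal (real (Suc m) * (B * \<nu>))" if "-1 \<le> a" "b \<le> 1"
      by (rule Cm_norm_le[OF \<open>smooth_on ?S f\<close> that])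
        (use \<open>\<nu> > 0\<close> B(1) \<open>\<And>j x. j \<le> Suc m \<Longrightarrow> x \<in> ?S \<Longrightarrow> \<bar>(deriv ^^ j) f x\<bar> \<le> B * \<nu>\<close> in auto)
  qed
  have data: "smooth_on ?S (\<lambda>x. U x - sqrt (2 * P c x))"
    "\<And>j x. j \<le> Suc m \<Longrightarrow> x \<in> ?S \<Longrightarrow> \<bar>(deriv ^^ j) (\<lambda>x. U x - sqrt (2 * P c x)) x\<bar> \<le> B * \<nu>"
    if "(\<nu>, s, c, U) \<in> upper_data \<delta> \<kappa>" for \<nu> s c U
  proof -
    show "smooth_on ?S (\<lambda>x. U x - sqrt (2 * P c x))"
      using unif_O_smooth[OF S O that] by simp
    have "\<nu> > 0" using that by (simp add: upper_data_def)
    then show "\<bar>(deriv ^^ j) (\<lambda>x. U x - sqrt (2 * P c x)) x\<bar> \<le> B * \<nu>" if "j \<le> Suc m" "x \<in> ?S" for j x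
      using B(2)[OF \<open>(\<nu>, s, c, U) \<in> upper_data \<delta> \<kappa>\<close> that] by simp
  qed
  define C where "C = 2 * (real (Suc m) * B) + 1"
  have bound: "Linf_norm ?S (\<lambda>x. Up x - sqrt (2 * P c x)) + Linf_norm ?S (\<lambda>x. Um x + sqrt (2 * P c x))
        \<le> ennreal (C * \<nu>) \<and>
      Cm_norm m (-1) (1 - \<epsilon>) (\<lambda>x. Up x - sqrt (2 * P c x))
        + Cm_norm m (-1 + \<epsilon>) 1 (\<lambda>x. Um x + sqrt (2 * P c x)) \<le> ennreal (C * \<nu>)"
    if \<nu>: "\<nu> > 0" and c: "c \<noteq> 0" and ratio: "norm c / \<nu>\<^sup>2 \<ge> 1 / \<kappa>\<^sup>2"
      and dist: "dist (c /\<^sub>R norm c) chat < h / 5"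
      and Up: "is_upper_solution \<nu> c Up" and Um: "is_lower_solution \<nu> c Um" for \<nu> c Up Um
  proof -
    define s where "s = sqrt (norm c)"
    have s: "s > 0" "s\<^sup>2 = norm c" using c by (auto simp: s_def)
    have "\<nu>\<^sup>2 \<le> (\<kappa> * s)\<^sup>2"
      using ratio \<nu> \<kappa> s(2) by (simp add: power_mult_distrib field_simps)
    then have \<nu>s: "\<nu> \<le> \<kappa> * s" using \<kappa> s(1) by (simp add: power2_le_iff_abs_le)
    have low: "(\<delta> * s)\<^sup>2 \<le> 2 * P c x" if "x \<in> ?S" for x
    proof -
      have "P (c /\<^sub>R norm c) x \<ge> h"
        using P_diff_le[OF that, of "c /\<^sub>R norm c" chat] h(2)[OF that] dist
        by (simp add: dist_norm abs_le_iff)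
      then have "s\<^sup>2 * h \<le> s\<^sup>2 * P (c /\<^sub>R norm c) x" by (intro mult_left_mono) auto
      also have "\<dots> = P c x" using c by (simp add: P_scaleR s(2))
      finally show ?thesis by (simp add: power_mult_distrib \<delta>(2) mult_ac)
    qed
    have ci: "\<bar>c $ i\<bar> \<le> s\<^sup>2" for i
      unfolding s(2) by (rule component_le_norm_cart)
    have up: "(\<nu>, s, c, Up) \<in> upper_data \<delta> \<kappa>"
      using \<nu> s(1) \<nu>s ci low Up by (simp add: upper_data_def)
    have dn: "(\<nu>, s, swap_ends c, \<lambda>x. - Um (- x)) \<in> upper_data \<delta> \<kappa>"
    proof -
      have "\<forall>i. \<bar>swap_ends c $ i\<bar> \<le> s\<^sup>2"
        unfolding forall_3 using ci by (simp add: swap_ends_def vector_3)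
      moreover have "\<forall>x\<in>?S. (\<delta> * s)\<^sup>2 \<le> 2 * P (swap_ends c) x"
        unfolding P_swap_ends by (auto intro!: low)
      ultimately show ?thesis
        using \<nu> s(1) \<nu>s lower_solution_reflect[OF \<nu> Um] by (simp add: upper_data_def)
    qed
    \<comment> \<open>The lower solution is the reflection of an upper solution, and so is its error term.\<close>
    define f where "f x = - Um (- x) - sqrt (2 * P (swap_ends c) x)" for x
    have f: "smooth_on ?S f" "\<And>j x. j \<le> Suc m \<Longrightarrow> x \<in> ?S \<Longrightarrow> \<bar>(deriv ^^ j) f x\<bar> \<le> B * \<nu>"
      unfolding f_def[abs_def] using data[OF dn] by blast+
    have fU: "(\<lambda>x. Um x + sqrt (2 * P c x)) = (\<lambda>x. - f (- x))"
        by (simp add: f_def P_swap_ends fun_eq_iff)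
    have sym: "- x \<in> ?S" if "x \<in> ?S" for x using that by auto
    have "smooth_on ?S (\<lambda>x. (- 1) * f (- x))"
      by (intro smooth_on_mult[OF S] smooth_on_const[OF S] smooth_on_reflect[OF S sym f(1)])
    then have g1: "smooth_on ?S (\<lambda>x. Um x + sqrt (2 * P c x))" unfolding fU by simp
    have g2: "\<bar>(deriv ^^ j) (\<lambda>x. Um x + sqrt (2 * P c x)) x\<bar> \<le> B * \<nu>" if "j \<le> Suc m" "x \<in> ?S" for j x
      using f(2)[OF that(1) sym[OF that(2)]] funpow_deriv_reflect[OF S sym f(1) that(2), of j]
      unfolding fU by (simp add: abs_mult power_abs)
    note U = norms[OF data(1)[OF up] \<nu> data(2)[OF up]]
    note L = norms[OF g1 \<nu> g2]
    have "1 * (B * \<nu>) \<le> real (Suc m) * (B * \<nu>)"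
      using B(1) \<nu> by (intro mult_right_mono) auto
    then have le: "B * \<nu> + B * \<nu> \<le> C * \<nu>" "real (Suc m) * (B * \<nu>) + real (Suc m) * (B * \<nu>) \<le> C * \<nu>"
      using \<nu> by (simp_all add: C_def algebra_simps)
    have add: "x + y \<le> ennreal (C * \<nu>)" if "x \<le> ennreal a" "y \<le> ennreal a" "a \<ge> 0" "a + a \<le> C * \<nu>"
      for x y a
    proof -
      have "x + y \<le> ennreal a + ennreal a" using that by (intro add_mono)
      also have "\<dots> = ennreal (a + a)" by (rule ennreal_plus[OF that(3) that(3), symmetric])
      also have "\<dots> \<le> ennreal (C * \<nu>)" using that(4) by (rule ennreal_leI)
      finally show ?thesis .
    qed
    have nn: "B * \<nu> \<ge> 0" "real (Suc m) * (B * \<nu>) \<ge> 0" using B(1) \<nu> by simp_all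
    show ?thesis
    proof
      show "Linf_norm ?S (\<lambda>x. Up x - sqrt (2 * P c x)) + Linf_norm ?S (\<lambda>x. Um x + sqrt (2 * P c x))
          \<le> ennreal (C * \<nu>)"
        by (rule add[OF U(1) L(1) nn(1) le(1)])
      show "Cm_norm m (-1) (1 - \<epsilon>) (\<lambda>x. Up x - sqrt (2 * P c x))
          + Cm_norm m (-1 + \<epsilon>) 1 (\<lambda>x. Um x + sqrt (2 * P c x)) \<le> ennreal (C * \<nu>)"
        by (rule add[OF U(2) L(2) nn(2) le(2)]) (use \<open>\<epsilon> > 0\<close> in auto)
    qed
  qed
  show ?thesis
  proof (intro exI[of _ C] conjI allI impI)
    show "C > 0" using B(1) by (simp add: C_def add_nonneg_pos)
    fix \<nu> :: "nat \<Rightarrow> real" and c :: "nat \<Rightarrow> real ^ 3" and Up Um :: "nat \<Rightarrow> real \<Rightarrow> real"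
    assume \<nu>: "\<forall>k. \<nu> k > 0" and lim: "filterlim (\<lambda>k. norm (c k) / (\<nu> k)\<^sup>2) at_top sequentially"
      and dir: "(\<lambda>k. c k /\<^sub>R norm (c k)) \<longlonglongrightarrow> chat"
      and Up: "\<forall>k. is_upper_solution (\<nu> k) (c k) (Up k)"
      and Um: "\<forall>k. is_lower_solution (\<nu> k) (c k) (Um k)"
    have "\<forall>\<^sub>F k in sequentially. norm (c k) / (\<nu> k)\<^sup>2 \<ge> 1 / \<kappa>\<^sup>2"
      using lim by (simp add: filterlim_at_top)
    moreover have "\<forall>\<^sub>F k in sequentially. dist (c k /\<^sub>R norm (c k)) chat < h / 5"
      using dir h(1) by (intro tendstoD) auto
    ultimately show "\<forall>\<^sub>F k in sequentially.
        Linf_norm {-1<..<1} (\<lambda>x. Up k x - sqrt (2 * P (c k) x))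
        + Linf_norm {-1<..<1} (\<lambda>x. Um k x + sqrt (2 * P (c k) x))
          \<le> ennreal (C * \<nu> k) \<and>
        Cm_norm m (-1) (1 - \<epsilon>) (\<lambda>x. Up k x - sqrt (2 * P (c k) x))
        + Cm_norm m (-1 + \<epsilon>) 1 (\<lambda>x. Um k x + sqrt (2 * P (c k) x))
          \<le> ennreal (C * \<nu> k)"
    proof eventually_elim
      case (elim k)
      have "1 / \<kappa>\<^sup>2 > 0" using \<kappa> by simp
      then have "c k \<noteq> 0" using elim(1) by auto
      then show ?case using bound elim \<nu> Up Um by blast
    qed
  qed
qed

end
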